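(* Let $k\in\mathbb{N}$ and let $u_1,\ldots,u_{2^k}$ be disjoint non-commutator words. Then the word $\delta_k(u_1,\ldots,u_{2^k})$ is boundedly concise. In particular, $\delta_k(x_1^{n_1},\ldots,x_{2^k}^{n_{2^k}})$ is boundedly concise for all $n_1,\ldots,n_{2^k}\in\mathbb{Z}\smallsetminus\{0\}$.
   Context: $\mathbb{N}$ denotes the positive integers. Words are elements of the free group $F$ of countable rank. For a word $w$ and a group $G$, $w\{G\}$ is the set of all values of $w$ in $G$ (obtained by substituting arbitrary elements of $G$ for the variables), and $w(G)=\langle w\{G\}\rangle$. A word $w$ is boundedly concise if there is a function $f_w:\mathbb{N}\to\mathbb{N}$ such that whenever $|w\{G\}|=m$ is finite for a group $G$, we have $|w(G)|\le f_w(m)$. Words are disjoint if the sets of variables that they involve are pairwise disjoint. A non-commutator word is a word lying outside $F'$; equivalently, the exponent sum of some variable in it is non-zero. Commutators are $[x,y]=x^{-1}y^{-1}xy$. The derived words are defined by $\delta_0=x_1$ and $\delta_k(x_1,\ldots,x_{2^k})=[\delta_{k-1}(x_1,\ldots,x_{2^{k-1}}),\delta_{k-1}(x_{2^{k-1}+1},\ldots,x_{2^k})]$; $\delta_k(u_1,\ldots,u_{2^k})$ is the word obtained by substituting $u_i$ for $x_i$. *)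

theory Defs
  imports "HOL-Algebra.Generated_Groups" "HOL-Library.Disjoint_Sets"
begin

text \<open>
  The free group on generators \<open>x\<^sub>i\<close> (\<open>i :: nat\<close>), whose elements are the reduced words.
  The letter \<open>(i, True)\<close> stands for \<open>x\<^sub>i\<close> and \<open>(i, False)\<close> for its inverse.
  The generator with index 0 is just one more variable; the derived words below
  only use \<open>x\<^sub>1, x\<^sub>2, \<dots>\<close>.
\<close>

type_synonym letter = "nat \<times> bool"
type_synonym word = "letter list"

definition inv_letter :: "letter \<Rightarrow> letter" where
  "inv_letter a = (fst a, \<not> snd a)"

definition reduced :: "word \<Rightarrow> bool" where
  "reduced w \<longleftrightarrow> successively (\<lambda>a b. b \<noteq> inv_letter a) w"

text \<open>Left multiplication of a reduced word by a letter.\<close>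

fun cons_letter :: "letter \<Rightarrow> word \<Rightarrow> word" where
  "cons_letter a [] = [a]"
| "cons_letter a (b # w) = (if b = inv_letter a then w else a # b # w)"

definition free_group :: "word monoid" (\<open>\<F>\<close>) where
  "\<F> = \<lparr> carrier = {w. reduced w}, mult = (\<lambda>u v. foldr cons_letter u v), one = [] \<rparr>"

definition var :: "nat \<Rightarrow> word" where
  "var i = [(i, True)]"

text \<open>The variables that a word, given in reduced form, involves.\<close>

definition vars :: "word \<Rightarrow> nat set" where
  "vars w = fst ` set w"

definition non_commutator_word :: "word \<Rightarrow> bool" where
  "non_commutator_word w \<longleftrightarrow> w \<in> carrier \<F> \<and> w \<notin> derived \<F> (carrier \<F>)"

text \<open>
  The value of a word in a group \<open>G\<close> under the substitution \<open>x\<^sub>i \<mapsto> g i\<close>. For \<open>G = \<F>\<close>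
  this is the substitution of the words \<open>g i\<close> for the variables \<open>x\<^sub>i\<close>.
\<close>

definition letter_val :: "('a, 'b) monoid_scheme \<Rightarrow> (nat \<Rightarrow> 'a) \<Rightarrow> letter \<Rightarrow> 'a" where
  "letter_val G g a = (if snd a then g (fst a) else inv\<^bsub>G\<^esub> g (fst a))"

definition word_val :: "('a, 'b) monoid_scheme \<Rightarrow> (nat \<Rightarrow> 'a) \<Rightarrow> word \<Rightarrow> 'a" where
  "word_val G g w = foldr (\<lambda>a y. letter_val G g a \<otimes>\<^bsub>G\<^esub> y) w \<one>\<^bsub>G\<^esub>"

definition word_values :: "word \<Rightarrow> ('a, 'b) monoid_scheme \<Rightarrow> 'a set" where
  "word_values w G = {word_val G g w | g. g \<in> UNIV \<rightarrow> carrier G}"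

definition verbal_subgroup :: "word \<Rightarrow> ('a, 'b) monoid_scheme \<Rightarrow> 'a set" where
  "verbal_subgroup w G = generate G (word_values w G)"

definition commutator :: "('a, 'b) monoid_scheme \<Rightarrow> 'a \<Rightarrow> 'a \<Rightarrow> 'a" where
  "commutator G x y = inv\<^bsub>G\<^esub> x \<otimes>\<^bsub>G\<^esub> inv\<^bsub>G\<^esub> y \<otimes>\<^bsub>G\<^esub> x \<otimes>\<^bsub>G\<^esub> y"

fun derived_word :: "nat \<Rightarrow> word" where
  "derived_word 0 = var 1"
| "derived_word (Suc k) =
     commutator \<F> (derived_word k) (word_val \<F> (\<lambda>i. var (2 ^ k + i)) (derived_word k))"

text \<open>\<open>f\<close> witnesses bounded conciseness of \<open>w\<close> among the groups with elements of type \<open>'a\<close>.\<close>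

definition concise_with :: "'a itself \<Rightarrow> word \<Rightarrow> (nat \<Rightarrow> nat) \<Rightarrow> bool" where
  "concise_with (_ :: 'a itself) w f \<longleftrightarrow>
     (\<forall>G :: 'a monoid. group G \<and> finite (word_values w G) \<longrightarrow>
        finite (verbal_subgroup w G) \<and>
        card (verbal_subgroup w G) \<le> f (card (word_values w G)))"

text \<open>
  Bounded conciseness asks for one function \<open>f\<^sub>w\<close> that works for all groups, whereas a
  quantifier over types cannot be placed below \<open>\<exists>f\<close>. The plain definition
  \<open>\<exists>f. concise_with TYPE('a) w f\<close> would let the function depend on the type \<open>'a\<close>. We therefore
  choose \<open>f\<^sub>w\<close> by looking only at groups with elements of type \<open>nat\<close>, so that it depends on
  \<open>w\<close> alone, and require the chosen function to work for \<open>'a\<close> as well; with \<open>'a\<close> left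
  arbitrary, \<open>boundedly_concise TYPE('a) w\<close> says that \<open>f\<^sub>w\<close> works for every group. No choice
  of \<open>f\<^sub>w\<close> is too small for this: if \<open>w\<close> has finitely many values in \<open>G\<close>, then it has the
  same values, and the same verbal subgroup, in some finitely generated (hence countable)
  subgroup of \<open>G\<close>. For \<open>'a = nat\<close> the definition amounts to \<open>\<exists>f. concise_with TYPE(nat) w f\<close>.
\<close>

definition conciseness_function :: "word \<Rightarrow> nat \<Rightarrow> nat" where
  "conciseness_function w = (SOME f. concise_with TYPE(nat) w f)"

definition boundedly_concise :: "'a itself \<Rightarrow> word \<Rightarrow> bool" where
  "boundedly_concise T w \<longleftrightarrow>
     concise_with TYPE(nat) w (conciseness_function w) \<and> concise_with T w (conciseness_function w)"

lemma inv_letter_inv_letter [simp]: "inv_letter (inv_letter a) = a"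
  by (simp add: inv_letter_def)

lemma reduced_Nil [simp]: "reduced []"
  by (simp add: reduced_def)

lemma reduced_ConsD: "reduced (a # w) \<Longrightarrow> reduced w"
  by (cases w) (auto simp: reduced_def)

lemma reduced_cons_letter: "reduced w \<Longrightarrow> reduced (cons_letter a w)"
proof (cases w)
  case (Cons b v)
  assume "reduced w"
  then show ?thesis using Cons reduced_ConsD[of b v] by (auto simp: reduced_def)
qed (simp add: reduced_def)

lemma reduced_foldr: "reduced w \<Longrightarrow> reduced (foldr cons_letter v w)"
  by (induction v) (auto intro: reduced_cons_letter)

lemma cons_letter_cancel:
  assumes "reduced w" shows "cons_letter a (cons_letter (inv_letter a) w) = w"
proof (cases w)
  case (Cons b v)
  then show ?thesis using assms by (cases v) (auto simp: reduced_def)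
qed auto

lemma foldr_cons_letter:
  assumes "reduced w"
  shows "foldr cons_letter (cons_letter a v) w = cons_letter a (foldr cons_letter v w)"
proof (cases v)
  case (Cons b v')
  then show ?thesis using cons_letter_cancel[of "foldr cons_letter v' w" a] assms
    by (auto simp: reduced_foldr)
qed auto

lemma foldr_foldr:
  "reduced w \<Longrightarrow> foldr cons_letter (foldr cons_letter u v) w = foldr cons_letter u (foldr cons_letter v w)"
  by (induction u) (auto simp: foldr_cons_letter)

lemma foldr_Nil: "reduced w \<Longrightarrow> foldr cons_letter w [] = w"
proof (induction w)
  case (Cons a w)
  then show ?case by (cases w) (auto dest: reduced_ConsD simp: reduced_def)
qed auto

lemma foldr_inverse:
  "reduced w \<Longrightarrow> foldr cons_letter (map inv_letter (rev u)) (foldr cons_letter u w) = w"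
proof (induction u arbitrary: w)
  case (Cons a u)
  then show ?case
    using cons_letter_cancel[of "foldr cons_letter u w" "inv_letter a"] by (simp add: reduced_foldr)
qed auto

lemma group_free_group: "group \<F>"
proof (rule groupI)
  fix u assume u: "u \<in> carrier \<F>"
  let ?v = "foldr cons_letter (map inv_letter (rev u)) []"
  have "?v \<otimes>\<^bsub>\<F>\<^esub> u = foldr cons_letter (map inv_letter (rev u)) (foldr cons_letter u [])"
    using u by (simp add: free_group_def foldr_foldr foldr_Nil)
  then have "?v \<otimes>\<^bsub>\<F>\<^esub> u = \<one>\<^bsub>\<F>\<^esub>"
    using foldr_inverse[of "[]" u] by (simp add: free_group_def)
  moreover have "?v \<in> carrier \<F>" by (simp add: free_group_def reduced_foldr)
  ultimately show "\<exists>v\<in>carrier \<F>. v \<otimes>\<^bsub>\<F>\<^esub> u = \<one>\<^bsub>\<F>\<^esub>" by blast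
qed (auto simp: free_group_def reduced_foldr foldr_foldr)

text \<open>The universal property of the free group.\<close>

lemma (in group) letter_val_closed:
  "g \<in> UNIV \<rightarrow> carrier G \<Longrightarrow> letter_val G g a \<in> carrier G"
  by (auto simp: letter_val_def Pi_iff)

lemma (in group) word_val_closed:
  "g \<in> UNIV \<rightarrow> carrier G \<Longrightarrow> word_val G g w \<in> carrier G"
  by (induction w) (auto simp: word_val_def letter_val_closed)

lemma (in group) word_val_cons_letter:
  assumes "g \<in> UNIV \<rightarrow> carrier G"
  shows "word_val G g (cons_letter a w) = letter_val G g a \<otimes> word_val G g w"
proof -
  have gi: "g i \<in> carrier G" for i using assms by auto
  have "letter_val G g a \<otimes> letter_val G g (inv_letter a) = \<one>"
    using gi by (auto simp: letter_val_def inv_letter_def)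
  then have "letter_val G g a \<otimes> (letter_val G g (inv_letter a) \<otimes> y) = y" if "y \<in> carrier G" for y
    using that assms by (simp add: letter_val_closed flip: m_assoc)
  then show ?thesis
    using word_val_closed[OF assms] by (cases w) (auto simp: word_val_def)
qed

lemma (in group) word_val_hom:
  assumes "g \<in> UNIV \<rightarrow> carrier G"
  shows "word_val G g \<in> hom \<F> G"
proof -
  have "word_val G g (foldr cons_letter u v) = word_val G g u \<otimes> word_val G g v" for u v
  proof (induction u)
    case Nil
    then show ?case using word_val_closed[OF assms] by (simp add: word_val_def)
  next
    case (Cons a u)
    have "word_val G g (a # u) = letter_val G g a \<otimes> word_val G g u" by (simp add: word_val_def)
    then show ?case using Cons assms
      by (simp add: word_val_cons_letter m_assoc word_val_closed letter_val_closed)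
  qed
  then show ?thesis using word_val_closed[OF assms] by (auto simp: hom_def free_group_def)
qed

lemma (in group) word_val_var: "g \<in> UNIV \<rightarrow> carrier G \<Longrightarrow> word_val G g (var i) = g i"
  by (auto simp: word_val_def var_def letter_val_def Pi_iff)

end

theory Submission
  imports Defs "HOL-Algebra.FiniteProduct" "HOL-Library.Countable_Set"
begin

text \<open>
  Let \<open>X\<close> be the set of values and \<open>L = \<langle>X\<rangle>\<close>. The core is that every homomorphism \<open>\<phi>\<close>
  from \<open>L\<close> to an abelian group satisfies \<open>\<phi>\<^sup>e = 1\<close> with \<open>e\<close> depending only on the word and on
  \<open>|\<phi>(X)|\<close>. For a single non-commutator word this holds because its values contain all \<open>n\<close>-th powers.
  For \<open>X = [X\<^sub>1, X\<^sub>2]\<close> with \<open>P = \<langle>X\<^sub>1\<rangle>\<close>, \<open>Q = \<langle>X\<^sub>2\<rangle>\<close>: if \<open>\<phi>\<close> is invariant under conjugation by \<open>P\<close> (or by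
  \<open>Q\<close>), then \<open>p \<mapsto> \<phi>([p, y])\<close> (or \<open>q \<mapsto> \<phi>([x, q])\<close>) is a homomorphism and induction applies. In general,
  putting \<open>c\<^sup>n\<close> with \<open>c \<in> L\<close> for the first entry gives left-normed values \<open>[c\<^sup>n, z\<^sub>1, \<dots>, z\<^sub>r]\<close> that are
  linear in \<open>c\<close> under \<open>\<phi>\<close>, so a bounded power of \<open>\<phi>\<close> kills \<open>[L, Z\<^sub>1, \<dots>, Z\<^sub>r]\<close>, where each
  \<open>\<langle>Z\<^sub>i\<rangle>\<close> contains \<open>P\<close> or \<open>Q\<close>. Peeling off the \<open>Z\<^sub>i\<close> one at a time reduces to the invariant case.
  Applied to the transfer of \<open>L\<close> into its centre, this bounds the orders of the elements of \<open>X\<close>, and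
  Dietzmann's lemma bounds \<open>|L|\<close>.
\<close>

section \<open>Words\<close>

interpretation F: group \<F>
  by (rule group_free_group)

lemma (in group) inv_mult_cancel [simp]:
  assumes "x \<in> carrier G" "y \<in> carrier G"
  shows "inv x \<otimes> (x \<otimes> y) = y" "x \<otimes> (inv x \<otimes> y) = y"
  using assms by (simp_all flip: m_assoc)

lemma word_val_cong: "(\<And>i. i \<in> vars w \<Longrightarrow> g i = h i) \<Longrightarrow> word_val G g w = word_val G h w"
  by (induction w) (auto simp: word_val_def vars_def letter_val_def)

lemma word_val_Cons: "word_val G g (a # w) = letter_val G g a \<otimes>\<^bsub>G\<^esub> word_val G g w"
  by (simp add: word_val_def)

lemma (in group) group_hom_word_val:
  "g \<in> UNIV \<rightarrow> carrier G \<Longrightarrow> group_hom \<F> G (word_val G g)"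
  by (simp add: group_hom_def group_hom_axioms_def word_val_hom group_free_group)

lemma (in group) word_val_subst:
  assumes u: "u \<in> UNIV \<rightarrow> carrier \<F>" and g: "g \<in> UNIV \<rightarrow> carrier G"
  shows "word_val G g (word_val \<F> u w) = word_val G (\<lambda>i. word_val G g (u i)) w"
proof -
  interpret h: group_hom \<F> G "word_val G g" using g by (rule group_hom_word_val)
  have ui: "u i \<in> carrier \<F>" for i using u by auto
  have l: "word_val G g (letter_val \<F> u a) = letter_val G (\<lambda>i. word_val G g (u i)) a" for a
    using ui by (simp add: letter_val_def)
  show ?thesis
  proof (induction w)
    case Nil
    then show ?case using h.hom_one by (simp add: word_val_def)
  next
    case (Cons a w)
    then show ?case
      using F.letter_val_closed[OF u] F.word_val_closed[OF u] by (simp add: word_val_Cons l)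
  qed
qed

section \<open>Variables occurring in products, inverses and derived words\<close>

lemma vars_foldr: "vars (foldr cons_letter u v) \<subseteq> vars u \<union> vars v"
proof (induction u)
  case (Cons a u)
  have "vars (cons_letter a w) \<subseteq> insert (fst a) (vars w)" for w
    by (cases w) (auto simp: vars_def)
  from this[of "foldr cons_letter u v"] Cons show ?case by (auto simp: vars_def)
qed (auto simp: vars_def)

lemma vars_mult: "vars (u \<otimes>\<^bsub>\<F>\<^esub> v) \<subseteq> vars u \<union> vars v"
  using vars_foldr[of u v] by (simp add: free_group_def)

lemma vars_inv:
  assumes "u \<in> carrier \<F>"
  shows "vars (inv\<^bsub>\<F>\<^esub> u) \<subseteq> vars u"
proof -
  \<comment> \<open>The formal inverse of \<open>u\<close>: the letters inverted, in reverse order.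
    Folding with \<open>cons_letter\<close> makes it reduced by construction.\<close>
  let ?v = "foldr cons_letter (map inv_letter (rev u)) []"
  have "?v \<otimes>\<^bsub>\<F>\<^esub> u = foldr cons_letter (map inv_letter (rev u)) (foldr cons_letter u [])"
    using assms by (simp add: free_group_def foldr_foldr foldr_Nil)
  then have "?v \<otimes>\<^bsub>\<F>\<^esub> u = \<one>\<^bsub>\<F>\<^esub>"
    using foldr_inverse[of "[]" u] by (simp add: free_group_def)
  moreover have "?v \<in> carrier \<F>" by (simp add: free_group_def reduced_foldr)
  ultimately have "inv\<^bsub>\<F>\<^esub> u = ?v"
    using assms F.inv_equality by blast
  moreover have "vars (map inv_letter (rev u)) \<subseteq> vars u"
    by (force simp: vars_def inv_letter_def)
  ultimately show ?thesis
    using vars_foldr[of "map inv_letter (rev u)" "[]"] by (auto simp: vars_def)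
qed

lemma var_closed [simp]: "var i \<in> carrier \<F>"
  by (simp add: var_def free_group_def reduced_def)

lemma vars_var [simp]: "vars (var i) = {i}"
  by (simp add: vars_def var_def)

lemma vars_word_val:
  assumes "u \<in> UNIV \<rightarrow> carrier \<F>"
  shows "vars (word_val \<F> u w) \<subseteq> (\<Union>i\<in>vars w. vars (u i))"
proof (induction w)
  case Nil
  then show ?case by (simp add: word_val_def vars_def free_group_def)
next
  case (Cons a w)
  have "vars (letter_val \<F> u a) \<subseteq> vars (u (fst a))"
    using assms vars_inv[of "u (fst a)"] by (auto simp: letter_val_def Pi_iff)
  moreover have "vars (a # w) = insert (fst a) (vars w)" by (simp add: vars_def)
  ultimately show ?case
    using Cons vars_mult[of "letter_val \<F> u a" "word_val \<F> u w"]
    unfolding word_val_Cons by auto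
qed

lemma (in group) commutator_closed [simp]:
  "x \<in> carrier G \<Longrightarrow> y \<in> carrier G \<Longrightarrow> commutator G x y \<in> carrier G"
  by (simp add: commutator_def)

lemma vars_commutator:
  assumes "x \<in> carrier \<F>" "y \<in> carrier \<F>"
  shows "vars (commutator \<F> x y) \<subseteq> vars x \<union> vars y"
proof -
  let ?a = "inv\<^bsub>\<F>\<^esub> x" and ?b = "inv\<^bsub>\<F>\<^esub> y"
  show ?thesis
    using vars_mult[of ?a ?b] vars_mult[of "?a \<otimes>\<^bsub>\<F>\<^esub> ?b" x] vars_mult[of "?a \<otimes>\<^bsub>\<F>\<^esub> ?b \<otimes>\<^bsub>\<F>\<^esub> x" y]
      vars_inv[OF assms(1)] vars_inv[OF assms(2)]
    unfolding commutator_def by blast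
qed

lemma derived_word_closed [simp]: "derived_word k \<in> carrier \<F>"
proof (induction k)
  case (Suc k)
  have "word_val \<F> (\<lambda>i. var (2 ^ k + i)) (derived_word k) \<in> carrier \<F>"
    by (rule F.word_val_closed) simp
  with Suc show ?case by simp
qed simp

text \<open>The second half of a derived word is a copy of the first with indices shifted by
  \<open>2 ^ k\<close>. The bound shows that the two halves share no index, so that their arguments
  can be chosen independently.\<close>

lemma vars_derived_word: "vars (derived_word k) \<subseteq> {1..2 ^ k}"
proof (induction k)
  case 0
  then show ?case by (simp add: vars_def var_def)
next
  case (Suc k)
  have "vars (word_val \<F> (\<lambda>i. var (2 ^ k + i)) (derived_word k))
    \<subseteq> (\<Union>i\<in>vars (derived_word k). vars (var (2 ^ k + i)))"
    by (rule vars_word_val) auto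
  also have "\<dots> \<subseteq> {1..2 ^ Suc k}" using Suc by (auto simp: vars_def var_def)
  finally have 1: "vars (word_val \<F> (\<lambda>i. var (2 ^ k + i)) (derived_word k)) \<subseteq> {1..2 ^ Suc k}" .
  have "vars (derived_word k) \<subseteq> {1..2 ^ Suc k}" using Suc by force
  with 1 show ?case
    using vars_commutator[of "derived_word k" "word_val \<F> (\<lambda>i. var (2 ^ k + i)) (derived_word k)"]
      F.word_val_closed[of "\<lambda>i. var (2 ^ k + i)" "derived_word k"] by auto
qed

lemma (in group) hom_commutator:
  assumes "group_hom G H h" "x \<in> carrier G" "y \<in> carrier G"
  shows "h (commutator G x y) = commutator H (h x) (h y)"
proof -
  interpret h: group_hom G H h by fact
  show ?thesis using assms(2,3) by (simp add: commutator_def)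
qed

lemma (in group) word_val_derived_word_Suc:
  assumes g: "g \<in> UNIV \<rightarrow> carrier G"
  shows "word_val G g (derived_word (Suc k)) =
    commutator G (word_val G g (derived_word k)) (word_val G (\<lambda>i. g (2 ^ k + i)) (derived_word k))"
  using F.hom_commutator[OF group_hom_word_val[OF g] derived_word_closed
      F.word_val_closed[of "\<lambda>i. var (2 ^ k + i)"]]
  by (simp add: word_val_subst[OF _ g] word_val_var[OF g])

section \<open>Exponent sums\<close>

text \<open>These are the coordinates of the image of a word in the abelianization of the free
  group. They make sense for unreduced letter lists too.\<close>

definition exponent_sum :: "nat \<Rightarrow> word \<Rightarrow> int" where
  "exponent_sum i w = (\<Sum>a\<leftarrow>w. if fst a = i then (if snd a then 1 else - 1) else 0)"

lemma exponent_sum_simps [simp]: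
  "exponent_sum i [] = 0"
  "exponent_sum i (a # w) = (if fst a = i then (if snd a then 1 else - 1) else 0) + exponent_sum i w"
  "exponent_sum i (v @ w) = exponent_sum i v + exponent_sum i w"
  by (simp_all add: exponent_sum_def)

lemma exponent_sum_cons_letter:
  "exponent_sum i (cons_letter a w) = exponent_sum i [a] + exponent_sum i w"
  by (cases w) (auto simp: inv_letter_def)

lemma exponent_sum_mult: "exponent_sum i (u \<otimes>\<^bsub>\<F>\<^esub> v) = exponent_sum i u + exponent_sum i v"
proof -
  have "exponent_sum i (foldr cons_letter u v) = exponent_sum i u + exponent_sum i v"
    by (induction u) (auto simp: exponent_sum_cons_letter)
  then show ?thesis by (simp add: free_group_def)
qed

lemma exponent_sum_one [simp]: "exponent_sum i \<one>\<^bsub>\<F>\<^esub> = 0"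
  by (simp add: free_group_def)

lemma exponent_sum_inv:
  assumes "u \<in> carrier \<F>"
  shows "exponent_sum i (inv\<^bsub>\<F>\<^esub> u) = - exponent_sum i u"
  using exponent_sum_mult[of i "inv\<^bsub>\<F>\<^esub> u" u] F.l_inv[OF assms] by simp

text \<open>Exponent sums are homomorphisms into the integers, so they vanish on
  commutators.\<close>

lemma exponent_sum_derived:
  assumes "w \<in> derived \<F> (carrier \<F>)"
  shows "exponent_sum i w = 0"
proof -
  have c: "derived_set \<F> (carrier \<F>) \<subseteq> carrier \<F>" by auto
  have "exponent_sum i x = 0" if "x \<in> derived_set \<F> (carrier \<F>)" for x
    using that by (auto simp: exponent_sum_mult exponent_sum_inv)
  with assms c show ?thesis
    unfolding derived_def
    by (induction rule: generate.induct) (auto simp: exponent_sum_mult exponent_sum_inv)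
qed

text \<open>Otherwise every occurrence of the variable of \<open>a\<close> carries the same sign as
  \<open>a\<close>, and its exponent sum cannot vanish.\<close>

lemma inv_letter_in_set:
  assumes "\<And>i. exponent_sum i (a # w) = 0"
  shows "inv_letter a \<in> set w"
proof (rule ccontr)
  assume n: "inv_letter a \<notin> set w"
  let ?s = "if snd a then 1 else - 1 :: int"
  have "0 \<le> ?s * exponent_sum (fst a) w" using n
  proof (induction w)
    case (Cons b w)
    then show ?case by (cases a; cases b) (auto simp: inv_letter_def split: if_splits)
  qed simp
  with assms[of "fst a"] show False by (auto split: if_splits)
qed

text \<open>Induction on the length: the first letter meets its inverse further on, and cancelling
  the two costs one commutator. Arbitrary letter lists are allowed because deleting the pair can
  leave an unreduced list.\<close>

lemma derived_if_exponent_sum_zero: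
  assumes "\<And>i. exponent_sum i w = 0"
  shows "foldr cons_letter w [] \<in> derived \<F> (carrier \<F>)"
  using assms
proof (induction w rule: length_induct)
  case (1 w)
  have D: "subgroup (derived \<F> (carrier \<F>)) \<F>"
    by (simp add: F.derived_is_subgroup)
  show ?case
  proof (cases w)
    case Nil
    then show ?thesis using subgroup.one_closed[OF D] by (simp add: free_group_def)
  next
    case (Cons a v)
    obtain p q where v: "v = p @ inv_letter a # q"
      using inv_letter_in_set[of a v] 1(2) Cons by (metis split_list)
    let ?c = "\<lambda>u. foldr cons_letter u []"
    have cl: "?c u \<in> carrier \<F>" for u by (simp add: free_group_def reduced_foldr)
    have ap: "?c (u @ u') = ?c u \<otimes>\<^bsub>\<F>\<^esub> ?c u'" for u u'
      using foldr_foldr[of "foldr cons_letter u' []" u "[]"] reduced_foldr[of "[]" u']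
      by (simp add: free_group_def foldr_foldr)
    have ci: "?c [inv_letter a] = inv\<^bsub>\<F>\<^esub> ?c [a]"
      by (rule F.inv_equality[symmetric], unfold ap[symmetric])
         (use cl in \<open>auto simp: free_group_def reduced_def\<close>)
    have "exponent_sum i (p @ q) = 0" for i
      using 1(2)[of i] Cons v by (auto simp: inv_letter_def split: if_splits)
    then have pq: "?c (p @ q) \<in> derived \<F> (carrier \<F>)"
      using 1(1) Cons v by (auto simp del: exponent_sum_simps foldr_append)
    have "?c w = ?c ([a] @ p @ [inv_letter a] @ q)" using Cons v by simp
    also have "\<dots> = ?c [a] \<otimes>\<^bsub>\<F>\<^esub> (?c p \<otimes>\<^bsub>\<F>\<^esub> (inv\<^bsub>\<F>\<^esub> ?c [a] \<otimes>\<^bsub>\<F>\<^esub> ?c q))"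
      by (simp only: ap ci)
    \<comment> \<open>The rewriting is \<open>a p a\<^sup>-\<^sup>1 q = (a p a\<^sup>-\<^sup>1
      p\<^sup>-\<^sup>1) (p q)\<close>, where \<open>p q\<close> is shorter than
      \<open>w\<close>.\<close>
    also have "\<dots> = (?c [a] \<otimes>\<^bsub>\<F>\<^esub> ?c p \<otimes>\<^bsub>\<F>\<^esub> inv\<^bsub>\<F>\<^esub> ?c [a] \<otimes>\<^bsub>\<F>\<^esub> inv\<^bsub>\<F>\<^esub> ?c p) \<otimes>\<^bsub>\<F>\<^esub> ?c (p @ q)"
      unfolding ap using cl[of "[a]"] cl[of p] cl[of q]
      by (simp add: F.m_assoc del: foldr.simps)
    finally have w: "?c w = (?c [a] \<otimes>\<^bsub>\<F>\<^esub> ?c p \<otimes>\<^bsub>\<F>\<^esub> inv\<^bsub>\<F>\<^esub> ?c [a] \<otimes>\<^bsub>\<F>\<^esub> inv\<^bsub>\<F>\<^esub> ?c p) \<otimes>\<^bsub>\<F>\<^esub> ?c (p @ q)" .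
    have "?c [a] \<otimes>\<^bsub>\<F>\<^esub> ?c p \<otimes>\<^bsub>\<F>\<^esub> inv\<^bsub>\<F>\<^esub> ?c [a] \<otimes>\<^bsub>\<F>\<^esub> inv\<^bsub>\<F>\<^esub> ?c p \<in> derived \<F> (carrier \<F>)"
      unfolding derived_def by (rule generate.incl) (use cl in blast)
    with pq show ?thesis unfolding w using subgroup.m_closed[OF D] by blast
  qed
qed

lemma non_commutator_word_exponent_sum:
  "non_commutator_word w \<longleftrightarrow> w \<in> carrier \<F> \<and> (\<exists>i. exponent_sum i w \<noteq> 0)"
proof -
  have "foldr cons_letter w [] = w" if "w \<in> carrier \<F>"
    using that by (simp add: foldr_Nil free_group_def)
  then show ?thesis
    unfolding non_commutator_word_def
    using exponent_sum_derived derived_if_exponent_sum_zero[of w] by metis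
qed

lemma exponent_sum_var [simp]: "exponent_sum i (var i) = 1"
  by (simp add: var_def)

lemma exponent_sum_int_pow:
  assumes "u \<in> carrier \<F>"
  shows "exponent_sum i (u [^]\<^bsub>\<F>\<^esub> (n :: int)) = n * exponent_sum i u"
proof -
  have *: "exponent_sum i (u [^]\<^bsub>\<F>\<^esub> (m :: nat)) = int m * exponent_sum i u" for m
    by (induction m) (auto simp: exponent_sum_mult algebra_simps)
  show ?thesis
    using assms by (cases n rule: int_cases2) (auto simp: * int_pow_int F.int_pow_neg_int exponent_sum_inv)
qed

lemma vars_int_pow:
  assumes "u \<in> carrier \<F>"
  shows "vars (u [^]\<^bsub>\<F>\<^esub> (n :: int)) \<subseteq> vars u"
proof -
  have *: "vars (u [^]\<^bsub>\<F>\<^esub> (m :: nat)) \<subseteq> vars u" for m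
  proof (induction m)
    case (Suc m)
    then show ?case using vars_mult[of "u [^]\<^bsub>\<F>\<^esub> m" u] by auto
  qed (simp add: vars_def free_group_def)
  have "vars (inv\<^bsub>\<F>\<^esub> (u [^]\<^bsub>\<F>\<^esub> (m :: nat))) \<subseteq> vars u" for m
    using vars_inv[of "u [^]\<^bsub>\<F>\<^esub> m"] *[of m] assms by auto
  with * assms show ?thesis
    by (cases n rule: int_cases2) (auto simp: int_pow_int F.int_pow_neg_int)
qed

text \<open>Substitute \<open>c\<close> for the variable with index \<open>i\<close> and the
  identity for all others.\<close>

lemma (in group) power_in_word_values:
  assumes c: "c \<in> carrier G"
  shows "c [^] exponent_sum i w \<in> word_values w G"
proof -
  let ?g = "\<lambda>j. if j = i then c else \<one>"
  have g: "?g \<in> UNIV \<rightarrow> carrier G" using c by auto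
  have "word_val G ?g w = c [^] exponent_sum i w"
  proof (induction w)
    case Nil
    then show ?case by (simp add: word_val_def)
  next
    case (Cons a w)
    have "letter_val G ?g a = c [^] (if fst a = i then (if snd a then 1 else - 1) else 0 :: int)"
      using c by (simp add: letter_val_def int_pow_neg)
    with Cons show ?case using c by (simp add: word_val_Cons int_pow_mult)
  qed
  with g show ?thesis
    unfolding word_values_def by (intro CollectI exI[of _ ?g] conjI) simp_all
qed

section \<open>Conjugation and commutators\<close>

definition conjugate :: "('a, 'b) monoid_scheme \<Rightarrow> 'a \<Rightarrow> 'a \<Rightarrow> 'a" where
  "conjugate G x g = inv\<^bsub>G\<^esub> g \<otimes>\<^bsub>G\<^esub> x \<otimes>\<^bsub>G\<^esub> g"

definition normal_set :: "('a, 'b) monoid_scheme \<Rightarrow> 'a set \<Rightarrow> bool" where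
  "normal_set G X \<longleftrightarrow> X \<subseteq> carrier G \<and> (\<forall>x\<in>X. \<forall>g\<in>carrier G. conjugate G x g \<in> X)"

definition comm_values :: "('a, 'b) monoid_scheme \<Rightarrow> 'a set \<Rightarrow> 'a set \<Rightarrow> 'a set" where
  "comm_values G X Y = {commutator G x y |x y. x \<in> X \<and> y \<in> Y}"

context group
begin

lemma conjugate_closed [simp]:
  "x \<in> carrier G \<Longrightarrow> g \<in> carrier G \<Longrightarrow> conjugate G x g \<in> carrier G"
  by (simp add: conjugate_def)

lemma conjugate_mult:
  assumes "x \<in> carrier G" "y \<in> carrier G" "g \<in> carrier G"
  shows "conjugate G (x \<otimes> y) g = conjugate G x g \<otimes> conjugate G y g"
  using assms by (simp add: conjugate_def m_assoc)

lemma conjugate_one [simp]: "g \<in> carrier G \<Longrightarrow> conjugate G \<one> g = \<one>"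
  by (simp add: conjugate_def)

lemma conjugate_by_one [simp]: "x \<in> carrier G \<Longrightarrow> conjugate G x \<one> = x"
  by (simp add: conjugate_def)

lemma conjugate_inv:
  assumes "x \<in> carrier G" "g \<in> carrier G"
  shows "conjugate G (inv x) g = inv (conjugate G x g)"
  using assms by (simp add: conjugate_def inv_mult_group m_assoc)

lemma conjugate_conjugate:
  assumes "x \<in> carrier G" "g \<in> carrier G" "h \<in> carrier G"
  shows "conjugate G (conjugate G x g) h = conjugate G x (g \<otimes> h)"
  using assms by (simp add: conjugate_def inv_mult_group m_assoc)

lemma conjugate_commutator:
  assumes "x \<in> carrier G" "y \<in> carrier G" "g \<in> carrier G"
  shows "conjugate G (commutator G x y) g = commutator G (conjugate G x g) (conjugate G y g)"
  using assms by (simp add: commutator_def conjugate_mult conjugate_inv)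

text \<open>Writing a commutator as a quotient of conjugates shows that it stays in any normal
  subgroup containing one entry, and lets homomorphisms be evaluated on it.\<close>

lemma commutator_conjugate:
  assumes "x \<in> carrier G" "y \<in> carrier G"
  shows "commutator G x y = inv x \<otimes> conjugate G x y"
    and "commutator G x y = inv (conjugate G y x) \<otimes> y"
    and "conjugate G x y = x \<otimes> commutator G x y"
  using assms by (simp_all add: commutator_def conjugate_def inv_mult_group m_assoc)

text \<open>The conjugation by \<open>y\<close> is the obstruction to linearity in the first entry;
  it disappears under a homomorphism that is invariant under conjugation by
  \<open>y\<close>.\<close>

lemma commutator_mult_left:
  assumes "x \<in> carrier G" "y \<in> carrier G" "z \<in> carrier G"
  shows "commutator G (x \<otimes> y) z = conjugate G (commutator G x z) y \<otimes> commutator G y z"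
  using assms by (simp add: commutator_def conjugate_def inv_mult_group m_assoc)

lemma commutator_mult_right:
  assumes "x \<in> carrier G" "y \<in> carrier G" "z \<in> carrier G"
  shows "commutator G x (y \<otimes> z) = commutator G x z \<otimes> conjugate G (commutator G x y) z"
  using assms by (simp add: commutator_def conjugate_def inv_mult_group m_assoc)

lemma commutator_inv_left:
  assumes "x \<in> carrier G" "y \<in> carrier G"
  shows "commutator G (inv x) y = conjugate G (inv (commutator G x y)) (inv x)"
  using assms by (simp add: commutator_def conjugate_def inv_mult_group m_assoc)

lemma commutator_inv_right:
  assumes "x \<in> carrier G" "y \<in> carrier G"
  shows "commutator G x (inv y) = conjugate G (inv (commutator G x y)) (inv y)"
  using assms by (simp add: commutator_def conjugate_def inv_mult_group m_assoc)

lemma commutator_one [simp]: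
  "x \<in> carrier G \<Longrightarrow> commutator G x \<one> = \<one>"
  "x \<in> carrier G \<Longrightarrow> commutator G \<one> x = \<one>"
  by (simp_all add: commutator_def)

lemma normal_set_generate:
  assumes "normal_set G X"
  shows "normal_set G (generate G X)"
proof -
  have X: "X \<subseteq> carrier G" using assms by (simp add: normal_set_def)
  have "conjugate G x g \<in> generate G X" if "x \<in> generate G X" "g \<in> carrier G" for x g
    using that(1)
  proof (induction rule: generate.induct)
    case one
    then show ?case using that(2) by (simp add: generate.one)
  next
    case (incl h)
    then show ?case using that(2) assms by (simp add: normal_set_def generate.incl)
  next
    case (inv h)
    then have "h \<in> carrier G" using X by auto
    then show ?case using inv that(2) assms by (simp add: conjugate_inv normal_set_def generate.inv)
  next
    case (eng h1 h2)
    then show ?case using that(2) generate_in_carrier[OF X] by (simp add: conjugate_mult generate.eng)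
  qed
  then show ?thesis
    using generate_incl[OF X] by (simp add: normal_set_def)
qed

lemma normal_set_comm_values:
  assumes "normal_set G X" "normal_set G Y"
  shows "normal_set G (comm_values G X Y)"
proof -
  have "X \<subseteq> carrier G" "Y \<subseteq> carrier G" using assms by (auto simp: normal_set_def)
  then show ?thesis
    using assms unfolding normal_set_def comm_values_def
    by (fastforce simp: conjugate_commutator subset_iff)
qed

lemma commutator_in_normal:
  assumes "subgroup L G" "normal_set G L" "l \<in> L" "g \<in> carrier G"
  shows "commutator G l g \<in> L" "commutator G g l \<in> L"
proof -
  have l: "l \<in> carrier G" using assms subgroup.mem_carrier by metis
  have c: "conjugate G l g \<in> L" using assms by (simp add: normal_set_def)
  show "commutator G l g \<in> L" "commutator G g l \<in> L"
    using assms c subgroup.m_closed[OF assms(1)] subgroup.m_inv_closed[OF assms(1)] l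
    by (simp_all add: commutator_conjugate(1)[of l g] commutator_conjugate(2)[of g l])
qed

lemma generate_comm_values_subset:
  assumes "normal_set G X" "normal_set G Y"
  shows "generate G (comm_values G X Y) \<subseteq> generate G X"
    and "generate G (comm_values G X Y) \<subseteq> generate G Y"
proof -
  have X: "X \<subseteq> carrier G" and Y: "Y \<subseteq> carrier G" using assms by (auto simp: normal_set_def)
  note s = generate_is_subgroup[OF X] generate_is_subgroup[OF Y]
  note n = assms[THEN normal_set_generate]
  show "generate G (comm_values G X Y) \<subseteq> generate G X"
    by (rule generate_subgroup_incl[OF _ s(1)])
       (use X Y in \<open>auto simp: comm_values_def intro!: commutator_in_normal(1)[OF s(1) n(1)] intro: generate.incl\<close>)
  show "generate G (comm_values G X Y) \<subseteq> generate G Y"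
    by (rule generate_subgroup_incl[OF _ s(2)])
       (use X Y in \<open>auto simp: comm_values_def intro!: commutator_in_normal(2)[OF s(2) n(2)] intro: generate.incl\<close>)
qed

text \<open>The product and inverse rules for commutators introduce conjugations, which the
  normality of \<open>L\<close> absorbs.\<close>

lemma commutator_generate_left:
  assumes L: "subgroup L G" "normal_set G L" and X: "X \<subseteq> carrier G" and q: "q \<in> carrier G"
    and XL: "\<And>x. x \<in> X \<Longrightarrow> commutator G x q \<in> L" and p: "p \<in> generate G X"
  shows "commutator G p q \<in> L"
  using p
proof (induction rule: generate.induct)
  case one
  then show ?case using q subgroup.one_closed[OF L(1)] by simp
next
  case (incl h)
  then show ?case by (rule XL)
next
  case (inv h)
  then have "h \<in> carrier G" using X by auto
  then show ?case
    using q XL[OF inv] L subgroup.m_inv_closed[OF L(1)]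
    by (simp add: commutator_inv_left normal_set_def)
next
  case (eng h1 h2)
  then show ?case
    using q L subgroup.m_closed[OF L(1)] generate_in_carrier[OF X]
    by (simp add: commutator_mult_left normal_set_def)
qed

lemma commutator_generate_right:
  assumes L: "subgroup L G" "normal_set G L" and Y: "Y \<subseteq> carrier G" and p: "p \<in> carrier G"
    and YL: "\<And>y. y \<in> Y \<Longrightarrow> commutator G p y \<in> L" and q: "q \<in> generate G Y"
  shows "commutator G p q \<in> L"
  using q
proof (induction rule: generate.induct)
  case one
  then show ?case using p subgroup.one_closed[OF L(1)] by simp
next
  case (incl h)
  then show ?case by (rule YL)
next
  case (inv h)
  then have "h \<in> carrier G" using Y by auto
  then show ?case
    using p YL[OF inv] L subgroup.m_inv_closed[OF L(1)]
    by (simp add: commutator_inv_right normal_set_def)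
next
  case (eng h1 h2)
  then show ?case
    using p L subgroup.m_closed[OF L(1)] generate_in_carrier[OF Y]
    by (simp add: commutator_mult_right normal_set_def)
qed

end

section \<open>Homomorphisms into abelian groups\<close>

text \<open>Two of the \<open>m + 1\<close> values at \<open>0, ..., m\<close> coincide, and a
  positive difference of at most \<open>m\<close> divides \<open>m!\<close>. This yields exponents
  depending only on \<open>m\<close>.\<close>

lemma pigeonhole_fact:
  fixes f :: "nat \<Rightarrow> 'b"
  assumes "\<And>j. f j \<in> S" "finite S" "card S \<le> m"
  obtains i j where "i < j" "f i = f j" "(j - i) dvd fact m"
proof -
  have "card (f ` {..m}) < card {..m}"
    using card_mono[of S "f ` {..m}"] assms by (simp add: image_subset_iff)
  then have "\<not> inj_on f {..m}" by (rule pigeonhole)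
  then obtain a b where ab: "a \<le> m" "b \<le> m" "a \<noteq> b" "f a = f b" by (auto simp: inj_on_def)
  have "(max a b - min a b) dvd fact m" using ab by (intro dvd_fact) auto
  moreover have "min a b < max a b" "f (min a b) = f (max a b)"
    using ab by (auto simp: min_def max_def)
  ultimately show ?thesis using that by blast
qed

context group
begin

lemma pow_eq_one_dvd:
  assumes "x \<in> carrier G" "x [^] (i :: nat) = \<one>" "i dvd j"
  shows "x [^] j = \<one>"
  using assms nat_pow_pow[of x i] by (metis dvdE nat_pow_one)

lemma pow_diff_eq_one:
  assumes x: "x \<in> carrier G" and "x [^] (i :: nat) = x [^] j" "i < j"
  shows "x [^] (j - i) = \<one>"
proof -
  have "x [^] i \<otimes> x [^] (j - i) = x [^] i \<otimes> \<one>"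
    using assms nat_pow_mult[OF x, of i "j - i"] by simp
  then show ?thesis using x by (simp del: r_one)
qed

text \<open>All powers of \<open>b = a\<^sup>n\<close> lie in \<open>S\<close>, since
  \<open>b\<^sup>j = (a\<^sup>j)\<^sup>n\<close>. Two of them coincide, so \<open>b\<close> has
  order dividing \<open>m!\<close>.\<close>

lemma pow_eq_one_if_finite:
  fixes n :: int
  assumes a: "a \<in> carrier G" and S: "\<And>j::nat. (a [^] j) [^] n \<in> S" "finite S" "card S \<le> m"
  shows "a [^] (nat \<bar>n\<bar> * fact m) = \<one>"
proof -
  let ?b = "a [^] n"
  have b: "?b \<in> carrier G" using a by simp
  have "?b [^] j = (a [^] j) [^] n" for j :: nat
    using a int_pow_pow[of a] by (simp add: mult.commute flip: int_pow_int)
  then have "?b [^] j \<in> S" for j :: nat using S(1) by simp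
  then obtain i j :: nat where "i < j" "?b [^] i = ?b [^] j" "(j - i) dvd fact m"
    using pigeonhole_fact[of "\<lambda>j. ?b [^] j"] S(2,3) by metis
  then have "?b [^] (fact m :: nat) = \<one>"
    using pow_eq_one_dvd[OF b] pow_diff_eq_one[OF b] by blast
  then have 1: "a [^] (n * int (fact m)) = \<one>"
    using a int_pow_pow[of a n "int (fact m)"] by (simp add: int_pow_int del: of_nat_fact)
  have "a [^] (\<bar>n\<bar> * int (fact m)) = \<one>"
  proof (cases "n \<ge> 0")
    case False
    then show ?thesis using 1 a int_pow_neg[of a "n * int (fact m)"] by (simp del: of_nat_fact)
  qed (use 1 in \<open>simp del: of_nat_fact\<close>)
  moreover have "\<bar>n\<bar> * int (fact m) = int (nat \<bar>n\<bar> * fact m)" by simp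
  ultimately show ?thesis using int_pow_int by metis
qed

text \<open>Homomorphisms out of a subgroup, restated with the operations of the ambient
  group.\<close>

lemma hom_on_subgroup:
  assumes "subgroup L G" "group A" "\<phi> \<in> hom (G\<lparr>carrier := L\<rparr>) A"
  shows "x \<in> L \<Longrightarrow> \<phi> x \<in> carrier A"
    and "x \<in> L \<Longrightarrow> y \<in> L \<Longrightarrow> \<phi> (x \<otimes> y) = \<phi> x \<otimes>\<^bsub>A\<^esub> \<phi> y"
    and "\<phi> \<one> = \<one>\<^bsub>A\<^esub>"
    and "x \<in> L \<Longrightarrow> \<phi> (inv x) = inv\<^bsub>A\<^esub> \<phi> x"
    and "x \<in> L \<Longrightarrow> \<phi> (x [^] (n::nat)) = \<phi> x [^]\<^bsub>A\<^esub> n"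
    and "x \<in> L \<Longrightarrow> \<phi> (x [^] (k::int)) = \<phi> x [^]\<^bsub>A\<^esub> k"
proof -
  interpret h: group_hom "G\<lparr>carrier := L\<rparr>" A \<phi>
    using assms subgroup_imp_group by (simp add: group_hom_def group_hom_axioms_def)
  show "x \<in> L \<Longrightarrow> \<phi> x \<in> carrier A" using h.hom_closed by simp
  show "x \<in> L \<Longrightarrow> y \<in> L \<Longrightarrow> \<phi> (x \<otimes> y) = \<phi> x \<otimes>\<^bsub>A\<^esub> \<phi> y" using h.hom_mult by simp
  show "\<phi> \<one> = \<one>\<^bsub>A\<^esub>" using h.hom_one by simp
  show "x \<in> L \<Longrightarrow> \<phi> (inv x) = inv\<^bsub>A\<^esub> \<phi> x" using h.hom_inv[of x] assms(1) by simp
  show "x \<in> L \<Longrightarrow> \<phi> (x [^] n) = \<phi> x [^]\<^bsub>A\<^esub> n"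
    using h.hom_nat_pow[of x n] nat_pow_consistent[of x n L] by simp
  show "x \<in> L \<Longrightarrow> \<phi> (x [^] k) = \<phi> x [^]\<^bsub>A\<^esub> k"
    using h.hom_int_pow[of x k] int_pow_consistent[OF assms(1), of x k] by simp
qed

lemma hom_pow:
  assumes L: "subgroup L G" and A: "comm_group A" and \<phi>: "\<phi> \<in> hom (G\<lparr>carrier := L\<rparr>) A"
  shows "(\<lambda>x. \<phi> x [^]\<^bsub>A\<^esub> (n::nat)) \<in> hom (G\<lparr>carrier := L\<rparr>) A"
proof -
  interpret A: comm_group A by fact
  note h = hom_on_subgroup[OF L A.group_axioms \<phi>]
  show ?thesis using h by (auto intro!: homI simp: A.nat_pow_distrib)
qed

lemma hom_pow_eq_one_generate:
  assumes X: "X \<subseteq> carrier G" and A: "comm_group A"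
    and \<phi>: "\<phi> \<in> hom (G\<lparr>carrier := generate G X\<rparr>) A"
    and one: "\<And>x. x \<in> X \<Longrightarrow> \<phi> x [^]\<^bsub>A\<^esub> (n::nat) = \<one>\<^bsub>A\<^esub>" and x: "x \<in> generate G X"
  shows "\<phi> x [^]\<^bsub>A\<^esub> n = \<one>\<^bsub>A\<^esub>"
proof -
  interpret A: comm_group A by fact
  note s = generate_is_subgroup[OF X]
  note h = hom_on_subgroup[OF s A.group_axioms hom_pow[OF s A \<phi>, of n]]
  show ?thesis using x
  proof (induction rule: generate.induct)
    case (inv x)
    then show ?case using h(4)[of x] one[of x] by (simp add: generate.incl)
  qed (use h one in auto)
qed

text \<open>Since \<open>\<phi>([l, z]) = \<phi>(l)\<^sup>-\<^sup>1 \<phi>(l\<^sup>z)\<close> and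
  the target is abelian, both factors are homomorphisms in \<open>l\<close>, and so is their
  product.\<close>

lemma hom_commutator_left:
  assumes L: "subgroup L G" "normal_set G L" and A: "comm_group A"
    and \<phi>: "\<phi> \<in> hom (G\<lparr>carrier := L\<rparr>) A" and z: "z \<in> carrier G"
  shows "(\<lambda>l. \<phi> (commutator G l z)) \<in> hom (G\<lparr>carrier := L\<rparr>) A"
proof -
  interpret A: comm_group A by fact
  note h = hom_on_subgroup[OF L(1) A.group_axioms \<phi>]
  have Lc: "l \<in> carrier G" if "l \<in> L" for l using that subgroup.mem_carrier[OF L(1)] by blast
  have e: "\<phi> (commutator G l z) = inv\<^bsub>A\<^esub> \<phi> l \<otimes>\<^bsub>A\<^esub> \<phi> (conjugate G l z)"
    and c: "conjugate G l z \<in> L" if "l \<in> L" for l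
    using that Lc[OF that] z h L subgroup.m_inv_closed[OF L(1)]
    by (simp_all add: commutator_conjugate(1) normal_set_def)
  show ?thesis
    using Lc z h c subgroup.m_closed[OF L(1)]
    by (auto intro!: homI simp: e A.inv_mult A.m_ac conjugate_mult)
qed

lemma hom_foldl_commutator:
  assumes L: "subgroup L G" "normal_set G L" and A: "comm_group A"
    and \<phi>: "\<phi> \<in> hom (G\<lparr>carrier := L\<rparr>) A" and zs: "set zs \<subseteq> carrier G"
  shows "(\<lambda>l. \<phi> (foldl (commutator G) l zs)) \<in> hom (G\<lparr>carrier := L\<rparr>) A"
  using zs
proof (induction zs)
  case (Cons z zs)
  then show ?case
    using hom_commutator_left[OF L A, of "\<lambda>l. \<phi> (foldl (commutator G) l zs)" z] by simp
qed (use \<phi> in simp)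

lemma conjugation_invariant_generate:
  assumes L: "subgroup L G" "normal_set G L" and Z: "Z \<subseteq> carrier G"
    and inv: "\<And>l z. l \<in> L \<Longrightarrow> z \<in> Z \<Longrightarrow> \<phi> (conjugate G l z) = \<phi> l"
    and z: "z \<in> generate G Z" and l: "l \<in> L"
  shows "\<phi> (conjugate G l z) = \<phi> l"
  using z l
proof (induction arbitrary: l rule: generate.induct)
  case one
  then show ?case using subgroup.mem_carrier[OF L(1)] by simp
next
  case (inv h)
  then have h: "h \<in> carrier G" "l \<in> carrier G" using Z subgroup.mem_carrier[OF L(1)] by auto
  \<comment> \<open>Invariance under \<open>h\<close>, applied to the conjugate of \<open>l\<close>
    by \<open>inv h\<close>, gives invariance under \<open>inv h\<close>.\<close>
  have "conjugate G l (inv h) \<in> L" using inv h L by (simp add: normal_set_def)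
  from assms(4)[OF this inv(1)] h show ?case by (simp add: conjugate_conjugate)
next
  case (eng h1 h2)
  have "h1 \<in> carrier G" "h2 \<in> carrier G" using eng generate_in_carrier[OF Z] by auto
  moreover have "conjugate G l h1 \<in> L" using eng calculation L by (simp add: normal_set_def)
  ultimately show ?case
    using eng.IH(1)[OF eng.prems] eng.IH(2)[of "conjugate G l h1"]
      conjugate_conjugate[of l h1 h2] subgroup.mem_carrier[OF L(1) eng.prems] by simp
qed (rule assms(4))

end

section \<open>Torsion bounds\<close>

text \<open>The target \<open>A\<close> has the same record type as \<open>G\<close>, which covers
  the later application to a subgroup of \<open>G\<close>. Letting \<open>m\<close> be any upper
  bound for the number of values spares a monotonicity proof for \<open>e\<close>.\<close>

definition torsion_bound :: "('a, 'b) monoid_scheme \<Rightarrow> 'a set \<Rightarrow> (nat \<Rightarrow> nat) \<Rightarrow> bool" where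
  "torsion_bound G X e \<longleftrightarrow>
     (\<forall>(A :: ('a, 'b) monoid_scheme) \<phi> m.
        comm_group A \<and> \<phi> \<in> hom (G\<lparr>carrier := generate G X\<rparr>) A \<and> finite (\<phi> ` X) \<and> card (\<phi> ` X) \<le> m \<longrightarrow>
        (\<forall>x\<in>generate G X. \<phi> x [^]\<^bsub>A\<^esub> e m = \<one>\<^bsub>A\<^esub>))"

lemma torsion_boundD:
  fixes A :: "('a, 'b) monoid_scheme" and G :: "('a, 'b) monoid_scheme"
  assumes "torsion_bound G X e" "comm_group A" "\<phi> \<in> hom (G\<lparr>carrier := generate G X\<rparr>) A"
    "finite (\<phi> ` X)" "card (\<phi> ` X) \<le> m" "x \<in> generate G X"
  shows "\<phi> x [^]\<^bsub>A\<^esub> e m = \<one>\<^bsub>A\<^esub>"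
  using assms unfolding torsion_bound_def by blast

text \<open>Peeling off one set costs the factor \<open>e m\<close> of the invariant case; the
  remaining sets are treated for a homomorphism with at most \<open>m * m\<close> values.\<close>

fun chain_exponent :: "(nat \<Rightarrow> nat) \<Rightarrow> nat \<Rightarrow> nat \<Rightarrow> nat" where
  "chain_exponent e 0 m = 1"
| "chain_exponent e (Suc r) m = chain_exponent e r (m * m) * e m"

text \<open>
  Besides a torsion bound \<open>e\<close>, the data record that the left-normed commutators
  \<open>[c\<^sup>n, z\<^sub>1, \<dots>, z\<^sub>r]\<close> with \<open>z\<^sub>i \<in> Z\<^sub>i\<close> lie in \<open>X\<close>. For a value set of \<open>\<delta>\<^sub>k\<close>, \<open>c\<^sup>n\<close> is the first entry and
  the \<open>Z\<^sub>i\<close> are the value sets of the siblings on the path from it to the root.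
\<close>

definition torsion_data :: "('a, 'b) monoid_scheme \<Rightarrow> 'a set \<Rightarrow> int \<Rightarrow> nat \<Rightarrow> (nat \<Rightarrow> nat) \<Rightarrow> bool" where
  "torsion_data G X n r e \<longleftrightarrow> normal_set G X \<and> torsion_bound G X e \<and>
     (\<exists>Zs. length Zs = r \<and>
        (\<forall>Z\<in>set Zs. normal_set G Z \<and> generate G X \<subseteq> generate G Z) \<and>
        (\<forall>c\<in>carrier G. \<forall>zs. list_all2 (\<in>) zs Zs \<longrightarrow> foldl (commutator G) (c [^]\<^bsub>G\<^esub> n) zs \<in> X))"

lemma list_all2_in_Union: "list_all2 (\<in>) zs Zs \<Longrightarrow> set zs \<subseteq> \<Union>(set Zs)"
  by (induction rule: list_all2_induct) auto

context group
begin

text \<open>For fixed \<open>y\<close>, invariance makes \<open>p \<mapsto> \<phi>([p, y])\<close> a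
  homomorphism on \<open>\<langle>X\<rangle>\<close>. It maps \<open>X\<close> into the values of
  \<open>\<phi>\<close> on commutators, so the bound for \<open>X\<close> applies to it. This
  settles the generators of \<open>L\<close>.\<close>

lemma torsion_left:
  fixes A :: "('a, 'b) monoid_scheme"
  assumes X: "normal_set G X" and Y: "normal_set G Y" and e: "torsion_bound G X e"
  defines "L \<equiv> generate G (comm_values G X Y)"
  assumes A: "comm_group A" and \<phi>: "\<phi> \<in> hom (G\<lparr>carrier := L\<rparr>) A"
    and fin: "finite (\<phi> ` comm_values G X Y)" "card (\<phi> ` comm_values G X Y) \<le> m"
    and inv: "\<And>l p. l \<in> L \<Longrightarrow> p \<in> generate G X \<Longrightarrow> \<phi> (conjugate G l p) = \<phi> l"
    and l: "l \<in> L"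
  shows "\<phi> l [^]\<^bsub>A\<^esub> e m = \<one>\<^bsub>A\<^esub>"
proof -
  interpret A: comm_group A by fact
  let ?C = "comm_values G X Y"
  have Xc: "X \<subseteq> carrier G" and Yc: "Y \<subseteq> carrier G" using X Y by (auto simp: normal_set_def)
  have nC: "normal_set G ?C" using X Y by (rule normal_set_comm_values)
  have Cc: "?C \<subseteq> carrier G" using nC by (simp add: normal_set_def)
  have L: "subgroup L G" "normal_set G L"
    using generate_is_subgroup[OF Cc] normal_set_generate[OF nC] by (simp_all add: L_def)
  note h = hom_on_subgroup[OF L(1) A.group_axioms \<phi>]
  have "\<phi> c [^]\<^bsub>A\<^esub> e m = \<one>\<^bsub>A\<^esub>" if C: "c \<in> ?C" for c
  proof -
    obtain x y where c: "c = commutator G x y" and xy: "x \<in> X" "y \<in> Y"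
      using C by (auto simp: comm_values_def)
    let ?\<psi> = "\<lambda>p. \<phi> (commutator G p y)"
    have y: "y \<in> carrier G" using xy Yc by auto
    have XL: "commutator G x' y \<in> L" if "x' \<in> X" for x'
      unfolding L_def by (rule generate.incl) (use that xy in \<open>auto simp: comm_values_def\<close>)
    have PL: "commutator G p y \<in> L" if "p \<in> generate G X" for p
      using commutator_generate_left[OF L Xc y] XL that by blast
    have "?\<psi> \<in> hom (G\<lparr>carrier := generate G X\<rparr>) A"
    proof (rule homI)
      fix p q assume "p \<in> carrier (G\<lparr>carrier := generate G X\<rparr>)" "q \<in> carrier (G\<lparr>carrier := generate G X\<rparr>)"
      then have pq: "p \<in> generate G X" "q \<in> generate G X" by auto
      then have "p \<in> carrier G" "q \<in> carrier G" using generate_in_carrier[OF Xc] by auto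
      then show "?\<psi> (p \<otimes>\<^bsub>G\<lparr>carrier := generate G X\<rparr>\<^esub> q) = ?\<psi> p \<otimes>\<^bsub>A\<^esub> ?\<psi> q"
        using pq PL inv[OF PL] h L y by (simp add: commutator_mult_left normal_set_def)
    qed (use h PL in simp)
    moreover have "?\<psi> ` X \<subseteq> \<phi> ` ?C" using xy by (auto simp: comm_values_def)
    then have "finite (?\<psi> ` X)" "card (?\<psi> ` X) \<le> m"
      using fin card_mono[of "\<phi> ` ?C" "?\<psi> ` X"] finite_subset[of "?\<psi> ` X"] by auto
    ultimately show ?thesis
      using torsion_boundD[OF e A] generate.incl[OF xy(1)] unfolding c by blast
  qed
  then show ?thesis
    using hom_pow_eq_one_generate[OF Cc A] \<phi> l unfolding L_def by blast
qed

text \<open>The mirror image of \<open>torsion_left\<close>. The right-hand product rule reverses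
  the two factors, which commute in \<open>A\<close>.\<close>

lemma torsion_right:
  fixes A :: "('a, 'b) monoid_scheme"
  assumes X: "normal_set G X" and Y: "normal_set G Y" and e: "torsion_bound G Y e"
  defines "L \<equiv> generate G (comm_values G X Y)"
  assumes A: "comm_group A" and \<phi>: "\<phi> \<in> hom (G\<lparr>carrier := L\<rparr>) A"
    and fin: "finite (\<phi> ` comm_values G X Y)" "card (\<phi> ` comm_values G X Y) \<le> m"
    and inv: "\<And>l p. l \<in> L \<Longrightarrow> p \<in> generate G Y \<Longrightarrow> \<phi> (conjugate G l p) = \<phi> l"
    and l: "l \<in> L"
  shows "\<phi> l [^]\<^bsub>A\<^esub> e m = \<one>\<^bsub>A\<^esub>"
proof -
  interpret A: comm_group A by fact
  let ?C = "comm_values G X Y"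
  have Xc: "X \<subseteq> carrier G" and Yc: "Y \<subseteq> carrier G" using X Y by (auto simp: normal_set_def)
  have nC: "normal_set G ?C" using X Y by (rule normal_set_comm_values)
  have Cc: "?C \<subseteq> carrier G" using nC by (simp add: normal_set_def)
  have L: "subgroup L G" "normal_set G L"
    using generate_is_subgroup[OF Cc] normal_set_generate[OF nC] by (simp_all add: L_def)
  note h = hom_on_subgroup[OF L(1) A.group_axioms \<phi>]
  have "\<phi> c [^]\<^bsub>A\<^esub> e m = \<one>\<^bsub>A\<^esub>" if C: "c \<in> ?C" for c
  proof -
    obtain x y where c: "c = commutator G x y" and xy: "x \<in> X" "y \<in> Y"
      using C by (auto simp: comm_values_def)
    let ?\<psi> = "\<lambda>q. \<phi> (commutator G x q)"
    have x: "x \<in> carrier G" using xy Xc by auto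
    have YL: "commutator G x y' \<in> L" if "y' \<in> Y" for y'
      unfolding L_def by (rule generate.incl) (use that xy in \<open>auto simp: comm_values_def\<close>)
    have QL: "commutator G x q \<in> L" if "q \<in> generate G Y" for q
      using commutator_generate_right[OF L Yc x] YL that by blast
    have "?\<psi> \<in> hom (G\<lparr>carrier := generate G Y\<rparr>) A"
    proof (rule homI)
      fix p q assume "p \<in> carrier (G\<lparr>carrier := generate G Y\<rparr>)" "q \<in> carrier (G\<lparr>carrier := generate G Y\<rparr>)"
      then have pq: "p \<in> generate G Y" "q \<in> generate G Y" by auto
      then have "p \<in> carrier G" "q \<in> carrier G" using generate_in_carrier[OF Yc] by auto
      then show "?\<psi> (p \<otimes>\<^bsub>G\<lparr>carrier := generate G Y\<rparr>\<^esub> q) = ?\<psi> p \<otimes>\<^bsub>A\<^esub> ?\<psi> q"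
        using pq QL inv[OF QL] h L x by (simp add: commutator_mult_right normal_set_def A.m_comm)
    qed (use h QL in simp)
    moreover have "?\<psi> ` Y \<subseteq> \<phi> ` ?C" using xy by (auto simp: comm_values_def)
    then have "finite (?\<psi> ` Y)" "card (?\<psi> ` Y) \<le> m"
      using fin card_mono[of "\<phi> ` ?C" "?\<psi> ` Y"] finite_subset[of "?\<psi> ` Y"] by auto
    ultimately show ?thesis
      using torsion_boundD[OF e A] generate.incl[OF xy(2)] unfolding c by blast
  qed
  then show ?thesis
    using hom_pow_eq_one_generate[OF Cc A] \<phi> l unfolding L_def by blast
qed

text \<open>
  The induction composes \<open>\<phi>\<close> with \<open>l \<mapsto> [l, z]\<close>, which squares the bound on the
  number of values.
\<close>

lemma chain_torsion:
  fixes A :: "('a, 'b) monoid_scheme"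
  assumes X: "normal_set G X" and A: "comm_group A"
    and Zs: "\<And>Z. Z \<in> set Zs \<Longrightarrow> Z \<subseteq> carrier G"
    and base: "\<And>Z \<phi> m l. Z \<in> set Zs \<Longrightarrow> \<phi> \<in> hom (G\<lparr>carrier := generate G X\<rparr>) A \<Longrightarrow>
      finite (\<phi> ` X) \<Longrightarrow> card (\<phi> ` X) \<le> m \<Longrightarrow>
      (\<And>l z. l \<in> generate G X \<Longrightarrow> z \<in> Z \<Longrightarrow> \<phi> (conjugate G l z) = \<phi> l) \<Longrightarrow>
      l \<in> generate G X \<Longrightarrow> \<phi> l [^]\<^bsub>A\<^esub> e m = \<one>\<^bsub>A\<^esub>"
    and \<phi>: "\<phi> \<in> hom (G\<lparr>carrier := generate G X\<rparr>) A"
    and fin: "finite (\<phi> ` X)" "card (\<phi> ` X) \<le> m"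
    and kill: "\<And>c zs. c \<in> generate G X \<Longrightarrow> list_all2 (\<in>) zs Zs \<Longrightarrow>
      \<phi> (foldl (commutator G) c zs) = \<one>\<^bsub>A\<^esub>"
    and l: "l \<in> generate G X"
  shows "\<phi> l [^]\<^bsub>A\<^esub> chain_exponent e (length Zs) m = \<one>\<^bsub>A\<^esub>"
  using Zs base \<phi> fin kill l
proof (induction Zs arbitrary: \<phi> m l rule: rev_induct)
  case Nil
  interpret A: comm_group A by fact
  have "X \<subseteq> carrier G" using X by (simp add: normal_set_def)
  then show ?case
    using Nil hom_on_subgroup(1)[OF generate_is_subgroup A.group_axioms Nil(3)] by simp
next
  case (snoc Z Zs)
  interpret A: comm_group A by fact
  have Xc: "X \<subseteq> carrier G" using X by (simp add: normal_set_def)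
  note L = generate_is_subgroup[OF Xc] normal_set_generate[OF X]
  note h = hom_on_subgroup[OF L(1) A.group_axioms snoc.prems(3)]
  \<comment> \<open>This is the exponent that the induction hypothesis gives for
    \<open>\<phi>\<close> composed with \<open>l \<mapsto> [l, z]\<close>, for each \<open>z\<close>
    in the last set \<open>Z\<close>. Hence \<open>?\<chi>\<close> is invariant under conjugation by
    \<open>Z\<close>, and \<open>base\<close> applies to it.\<close>
  let ?k = "chain_exponent e (length Zs) (m * m)"
  let ?\<chi> = "\<lambda>x. \<phi> x [^]\<^bsub>A\<^esub> ?k"
  have inv: "?\<chi> (conjugate G l z) = ?\<chi> l" if l: "l \<in> generate G X" and z: "z \<in> Z" for l z
  proof -
    let ?\<psi> = "\<lambda>l. \<phi> (commutator G l z)"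
    have zc: "z \<in> carrier G" using z snoc.prems(1)[of Z] by auto
    have lc: "l \<in> carrier G" using l generate_in_carrier[OF Xc] by auto
    \<comment> \<open>By normality \<open>x\<close> and its conjugate by \<open>z\<close> both lie
      in \<open>X\<close>, so \<open>[x, z]\<close> is mapped to a quotient of two values of
      \<open>\<phi>\<close> on \<open>X\<close>.\<close>
    have "?\<psi> ` X \<subseteq> (\<lambda>(a, b). inv\<^bsub>A\<^esub> a \<otimes>\<^bsub>A\<^esub> b) ` (\<phi> ` X \<times> \<phi> ` X)"
    proof safe
      fix x assume x: "x \<in> X"
      then have xc: "x \<in> carrier G" using Xc by auto
      have c: "conjugate G x z \<in> X" using X x zc by (simp add: normal_set_def)
      have "?\<psi> x = inv\<^bsub>A\<^esub> \<phi> x \<otimes>\<^bsub>A\<^esub> \<phi> (conjugate G x z)"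
        using x c generate.incl[of _ X G] h(2,4) subgroup.m_inv_closed[OF L(1)]
        by (simp add: commutator_conjugate(1) xc zc)
      then show "?\<psi> x \<in> (\<lambda>(a, b). inv\<^bsub>A\<^esub> a \<otimes>\<^bsub>A\<^esub> b) ` (\<phi> ` X \<times> \<phi> ` X)"
        using x c by auto
    qed
    from finite_subset[OF this] surj_card_le[OF _ this] snoc.prems(4)
    have f1: "finite (?\<psi> ` X)" and c: "card (?\<psi> ` X) \<le> card (\<phi> ` X) * card (\<phi> ` X)"
      by (simp_all add: card_cartesian_product)
    have f2: "card (?\<psi> ` X) \<le> m * m"
      using c mult_le_mono[OF snoc.prems(5) snoc.prems(5)] by (rule order_trans)
    \<comment> \<open>Appending \<open>z\<close> to \<open>zs\<close> gives a list for the longer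
      chain, whose commutators \<open>\<phi>\<close> kills.\<close>
    have kl: "?\<psi> (foldl (commutator G) c zs) = \<one>\<^bsub>A\<^esub>"
      if "c \<in> generate G X" "list_all2 (\<in>) zs Zs" for c zs
      using snoc.prems(6)[of c "zs @ [z]"] that z by (simp add: list_all2_appendI)
    have "?\<psi> l [^]\<^bsub>A\<^esub> ?k = \<one>\<^bsub>A\<^esub>"
    proof (rule snoc.IH[OF _ _ hom_commutator_left[OF L A snoc.prems(3) zc] f1 f2 kl l])
      fix Z' \<phi>' m' l'
      assume "Z' \<in> set Zs"
      then have Z': "Z' \<in> set (Zs @ [Z])" by simp
      show "Z' \<subseteq> carrier G" by (rule snoc.prems(1)[OF Z'])
      assume "\<phi>' \<in> hom (G\<lparr>carrier := generate G X\<rparr>) A" "finite (\<phi>' ` X)" "card (\<phi>' ` X) \<le> m'"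
        "\<And>l z. l \<in> generate G X \<Longrightarrow> z \<in> Z' \<Longrightarrow> \<phi>' (conjugate G l z) = \<phi>' l" "l' \<in> generate G X"
      then show "\<phi>' l' [^]\<^bsub>A\<^esub> e m' = \<one>\<^bsub>A\<^esub>" by (rule snoc.prems(2)[OF Z'])
    qed
    moreover have "commutator G l z \<in> generate G X"
      using commutator_in_normal[OF L l zc] by blast
    \<comment> \<open>Here \<open>l\<^sup>z = l [l, z]\<close>, and the power \<open>?k\<close>
      kills the second factor.\<close>
    ultimately show ?thesis
      using h l by (simp add: commutator_conjugate(3)[OF lc zc] A.nat_pow_distrib)
  qed
  have "?\<chi> \<in> hom (G\<lparr>carrier := generate G X\<rparr>) A"
    by (rule hom_pow[OF L(1) A snoc.prems(3)])
  moreover have "?\<chi> ` X = (\<lambda>a. a [^]\<^bsub>A\<^esub> ?k) ` \<phi> ` X" by auto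
  then have "finite (?\<chi> ` X)" "card (?\<chi> ` X) \<le> m"
    using snoc.prems(4,5) card_image_le[of "\<phi> ` X" "\<lambda>a. a [^]\<^bsub>A\<^esub> ?k"] by auto
  ultimately have "?\<chi> l [^]\<^bsub>A\<^esub> e m = \<one>\<^bsub>A\<^esub>"
    using inv snoc.prems(7) by (intro snoc.prems(2)[of Z ?\<chi> m l]) simp_all
  then show ?case using h(1) snoc.prems(7) by (simp add: A.nat_pow_pow)
qed

text \<open>The base case: for \<open>x\<close> in \<open>\<langle>S\<rangle>\<close> all elements
  \<open>(x\<^sup>j)\<^sup>n\<close> lie in \<open>S\<close>, so the powers of
  \<open>\<phi>(x)\<^sup>n\<close> take at most \<open>m\<close> values. The chain of sibling sets
  is empty.\<close>

lemma torsion_data_powers: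
  assumes S: "normal_set G S" and n: "\<And>c. c \<in> carrier G \<Longrightarrow> c [^] (n :: int) \<in> S"
  shows "torsion_data G S n 0 (\<lambda>m. nat \<bar>n\<bar> * fact m)"
proof -
  have Sc: "S \<subseteq> carrier G" using S by (simp add: normal_set_def)
  have "\<phi> x [^]\<^bsub>A\<^esub> (nat \<bar>n\<bar> * fact m) = \<one>\<^bsub>A\<^esub>"
    if A: "comm_group A" and \<phi>: "\<phi> \<in> hom (G\<lparr>carrier := generate G S\<rparr>) A"
      and fin: "finite (\<phi> ` S)" "card (\<phi> ` S) \<le> m" and x: "x \<in> generate G S"
    for A :: "('a, 'b) monoid_scheme" and \<phi> x m
  proof -
    interpret A: comm_group A by fact
    note L = generate_is_subgroup[OF Sc]
    note h = hom_on_subgroup[OF L A.group_axioms \<phi>]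
    have x': "x \<in> carrier G" using x generate_in_carrier[OF Sc] by auto
    have xj: "x [^] j \<in> generate G S" for j :: nat
      using x x' subgroup_int_pow_closed[OF L x, of "int j"] by (simp add: int_pow_int)
    have "(\<phi> x [^]\<^bsub>A\<^esub> j) [^]\<^bsub>A\<^esub> n = \<phi> ((x [^] j) [^] n)" for j :: nat
      using h(5)[OF x] h(6)[OF xj] by simp
    then have "(\<phi> x [^]\<^bsub>A\<^esub> j) [^]\<^bsub>A\<^esub> n \<in> \<phi> ` S" for j :: nat using n x' by simp
    then show ?thesis using A.pow_eq_one_if_finite[OF h(1)[OF x] _ fin] by blast
  qed
  then have "torsion_bound G S (\<lambda>m. nat \<bar>n\<bar> * fact m)" unfolding torsion_bound_def by blast
  then show ?thesis using S n by (simp add: torsion_data_def)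
qed

text \<open>The chain for \<open>X\<close> is extended by \<open>Y\<close>. One power of
  \<open>\<phi>\<close> kills the left-normed commutators along the chain, and
  \<open>chain_torsion\<close> then reduces to homomorphisms invariant under one set of the
  chain.\<close>

lemma torsion_data_comm_values:
  assumes dX: "torsion_data G X n r d" and dY: "torsion_data G Y n' r' e"
  shows "torsion_data G (comm_values G X Y) n (Suc r)
    (\<lambda>m. (nat \<bar>n\<bar> * fact m) * chain_exponent (\<lambda>m. d m * e m) (Suc r) m)"
proof -
  obtain Zs where Zs: "length Zs = r" "\<And>Z. Z \<in> set Zs \<Longrightarrow> normal_set G Z"
      "\<And>Z. Z \<in> set Zs \<Longrightarrow> generate G X \<subseteq> generate G Z"
    and sub: "\<And>c zs. c \<in> carrier G \<Longrightarrow> list_all2 (\<in>) zs Zs \<Longrightarrow> foldl (commutator G) (c [^] n) zs \<in> X"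
    and X: "normal_set G X" and tX: "torsion_bound G X d"
    using dX unfolding torsion_data_def by blast
  have Y: "normal_set G Y" and tY: "torsion_bound G Y e" using dY by (simp_all add: torsion_data_def)
  have Xc: "X \<subseteq> carrier G" and Yc: "Y \<subseteq> carrier G" using X Y by (auto simp: normal_set_def)
  let ?C = "comm_values G X Y"
  let ?Zs = "Zs @ [Y]"
  have nC: "normal_set G ?C" using X Y by (rule normal_set_comm_values)
  have Cc: "?C \<subseteq> carrier G" using nC by (simp add: normal_set_def)
  note L = generate_is_subgroup[OF Cc] normal_set_generate[OF nC]
  note LXY = generate_comm_values_subset[OF X Y]
  have Zc: "Z \<subseteq> carrier G" if "Z \<in> set ?Zs" for Z
    using that Zs(2)[of Z] Yc by (auto simp: normal_set_def)
  have sub': "foldl (commutator G) (c [^] n) zs \<in> ?C"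
    if c: "c \<in> carrier G" and zs: "list_all2 (\<in>) zs ?Zs" for c zs
  proof -
    obtain zs' y where z: "zs = zs' @ [y]" "list_all2 (\<in>) zs' Zs" "y \<in> Y"
      using zs unfolding list_all2_append2 list_all2_Cons2 by auto
    then show ?thesis using sub[OF c z(2)] by (auto simp: comm_values_def)
  qed
  have "\<phi> x [^]\<^bsub>A\<^esub> ((nat \<bar>n\<bar> * fact m) * chain_exponent (\<lambda>m. d m * e m) (Suc r) m) = \<one>\<^bsub>A\<^esub>"
    if A: "comm_group A" and \<phi>: "\<phi> \<in> hom (G\<lparr>carrier := generate G ?C\<rparr>) A"
      and fin: "finite (\<phi> ` ?C)" "card (\<phi> ` ?C) \<le> m" and x: "x \<in> generate G ?C"
    for A :: "('a, 'b) monoid_scheme" and \<phi> x m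
  proof -
    interpret A: comm_group A by fact
    \<comment> \<open>The exponent for the left-normed commutators
      \<open>[c, z\<^sub>1, ..., z\<^sub>r, y]\<close> with \<open>c\<close> in the subgroup
      generated by \<open>?C\<close>.\<close>
    let ?k = "nat \<bar>n\<bar> * fact m"
    let ?\<chi> = "\<lambda>x. \<phi> x [^]\<^bsub>A\<^esub> ?k"
    note h = hom_on_subgroup[OF L(1) A.group_axioms \<phi>]
    have \<chi>: "?\<chi> \<in> hom (G\<lparr>carrier := generate G ?C\<rparr>) A" by (rule hom_pow[OF L(1) A \<phi>])
    have base: "\<psi> l [^]\<^bsub>A\<^esub> (d m * e m) = \<one>\<^bsub>A\<^esub>"
      if Z: "Z \<in> set ?Zs" and \<psi>: "\<psi> \<in> hom (G\<lparr>carrier := generate G ?C\<rparr>) A"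
        and fin: "finite (\<psi> ` ?C)" "card (\<psi> ` ?C) \<le> m"
        and inv: "\<And>l z. l \<in> generate G ?C \<Longrightarrow> z \<in> Z \<Longrightarrow> \<psi> (conjugate G l z) = \<psi> l"
        and l: "l \<in> generate G ?C" for Z \<psi> m l
    proof -
      have inv': "\<psi> (conjugate G l z) = \<psi> l" if "l \<in> generate G ?C" "z \<in> generate G Z" for l z
        using conjugation_invariant_generate[OF L Zc[OF Z] inv that(2,1)] .
      have \<psi>l: "\<psi> l \<in> carrier A" using hom_on_subgroup(1)[OF L(1) A.group_axioms \<psi> l] .
      show ?thesis
      \<comment> \<open>Invariance holds under \<open>\<langle>Y\<rangle>\<close> in the first case
        and under \<open>\<langle>X\<rangle>\<close>, contained in
        \<open>\<langle>Z\<rangle>\<close>, in the second. The product \<open>d m * e m\<close>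
        serves both.\<close>
      proof (cases "Z = Y")
        case True
        have "\<psi> l [^]\<^bsub>A\<^esub> e m = \<one>\<^bsub>A\<^esub>"
          using inv' True by (intro torsion_right[OF X Y tY A \<psi> fin _ l]) auto
        then show ?thesis using \<psi>l A.pow_eq_one_dvd by simp
      next
        case False
        then have "generate G X \<subseteq> generate G Z" using Z Zs(3) by auto
        then have "\<psi> l [^]\<^bsub>A\<^esub> d m = \<one>\<^bsub>A\<^esub>"
          using inv' by (intro torsion_left[OF X Y tX A \<psi> fin _ l]) auto
        then show ?thesis using \<psi>l A.pow_eq_one_dvd by simp
      qed
    qed
    have kill: "?\<chi> (foldl (commutator G) c zs) = \<one>\<^bsub>A\<^esub>"
      if c: "c \<in> generate G ?C" and zs: "list_all2 (\<in>) zs ?Zs" for c zs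
    proof -
      let ?\<theta> = "\<lambda>l. \<phi> (foldl (commutator G) l zs)"
      have "set zs \<subseteq> carrier G"
        using list_all2_in_Union[OF zs] Zc by blast
      then have "?\<theta> \<in> hom (G\<lparr>carrier := generate G ?C\<rparr>) A"
        by (rule hom_foldl_commutator[OF L A \<phi>])
      note t = hom_on_subgroup[OF L(1) A.group_axioms this]
      have c': "c \<in> carrier G" using c generate_in_carrier[OF Cc] by auto
      have cj: "c [^] j \<in> generate G ?C" for j :: nat
        using c subgroup_int_pow_closed[OF L(1) c, of "int j"] by (simp add: int_pow_int)
      \<comment> \<open>As \<open>?\<theta>\<close> is a homomorphism, powers of its value at
        \<open>c\<close> can be moved inside, where \<open>sub'\<close> places the commutator in
        \<open>?C\<close>.\<close>
      have "(?\<theta> c [^]\<^bsub>A\<^esub> j) [^]\<^bsub>A\<^esub> n = ?\<theta> ((c [^] j) [^] n)" for j :: nat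
        using t(5)[OF c, of j] t(6)[OF cj, of j n] by simp
      then have "(?\<theta> c [^]\<^bsub>A\<^esub> j) [^]\<^bsub>A\<^esub> n \<in> \<phi> ` ?C" for j :: nat using sub'[OF _ zs] c' by simp
      then show ?thesis using A.pow_eq_one_if_finite[OF t(1)[OF c] _ fin] by blast
    qed
    have "?\<chi> ` ?C = (\<lambda>a. a [^]\<^bsub>A\<^esub> ?k) ` \<phi> ` ?C" by auto
    then have fin': "finite (?\<chi> ` ?C)" "card (?\<chi> ` ?C) \<le> m"
      using fin card_image_le[of "\<phi> ` ?C" "\<lambda>a. a [^]\<^bsub>A\<^esub> ?k"] by auto
    have "?\<chi> x [^]\<^bsub>A\<^esub> chain_exponent (\<lambda>m. d m * e m) (length ?Zs) m = \<one>\<^bsub>A\<^esub>"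
    proof (rule chain_torsion[where e = "\<lambda>m. d m * e m" and \<phi> = ?\<chi>, OF nC A Zc _ \<chi> fin' kill x])
      fix Z \<psi> m' l
      assume "Z \<in> set ?Zs" "\<psi> \<in> hom (G\<lparr>carrier := generate G ?C\<rparr>) A" "finite (\<psi> ` ?C)" "card (\<psi> ` ?C) \<le> m'"
        "\<And>l z. l \<in> generate G ?C \<Longrightarrow> z \<in> Z \<Longrightarrow> \<psi> (conjugate G l z) = \<psi> l" "l \<in> generate G ?C"
      then show "\<psi> l [^]\<^bsub>A\<^esub> (d m' * e m') = \<one>\<^bsub>A\<^esub>" by (rule base)
    qed
    then show ?thesis using h(1)[OF x] Zs(1) by (simp add: A.nat_pow_pow)
  qed
  then have "torsion_bound G ?C (\<lambda>m. (nat \<bar>n\<bar> * fact m) * chain_exponent (\<lambda>m. d m * e m) (Suc r) m)"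
    unfolding torsion_bound_def by blast
  moreover have "generate G ?C \<subseteq> generate G Z" if "Z \<in> set ?Zs" for Z
    using that LXY Zs(3) by auto
  moreover have "normal_set G Z" if "Z \<in> set ?Zs" for Z using that Zs(2) Y by auto
  ultimately show ?thesis
    unfolding torsion_data_def using nC sub' Zs(1) by (intro conjI exI[of _ ?Zs]) auto
qed

end

section \<open>Groups generated by a finite normal set\<close>

context group
begin

text \<open>
  The subgroup \<open>Z\<close> below is the centre of \<open>W = \<langle>X\<rangle>\<close>. It has index at most \<open>m ^ m\<close>,
  and the torsion bound is applied to the transfer \<open>W \<rightarrow> Z\<close>.
\<close>

lemma pow_eq_one_if_torsion_bound:
  assumes X: "normal_set G X" and fin: "finite X" and e: "torsion_bound G X e" and x: "x \<in> X"
  defines "m \<equiv> card X"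
  shows "x [^] (fact (m ^ m) * fact (m ^ m) * e m) = \<one>"
proof -
  have Xc: "X \<subseteq> carrier G" using X by (simp add: normal_set_def)
  define W where "W = generate G X"
  have W: "subgroup W G" unfolding W_def using Xc by (rule generate_is_subgroup)
  have Wc: "w \<in> carrier G" if "w \<in> W" for w using that subgroup.mem_carrier[OF W] by blast
  have Wm: "v \<otimes> w \<in> W" if "v \<in> W" "w \<in> W" for v w using that subgroup.m_closed[OF W] by blast
  have Wi: "inv w \<in> W" if "w \<in> W" for w using that subgroup.m_inv_closed[OF W] by blast
  have xc: "y \<in> carrier G" if "y \<in> X" for y using that Xc by auto
  have cX: "conjugate G y w \<in> X" if "y \<in> X" "w \<in> W" for y w
    using that Wc X by (simp add: normal_set_def)
  define Z where "Z = {z \<in> W. \<forall>y\<in>X. conjugate G y z = y}"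
  have ZW: "z \<in> W" if "z \<in> Z" for z using that by (simp add: Z_def)
  have Z: "subgroup Z G"
  proof (rule subgroupI)
    show "Z \<subseteq> carrier G" using ZW Wc by auto
    show "Z \<noteq> {}" using subgroup.one_closed[OF W] Xc by (auto simp: Z_def subset_iff)
    fix a assume a: "a \<in> Z"
    have "conjugate G y (inv a) = y" if "y \<in> X" for y
      using conjugate_conjugate[of y a "inv a"] a that xc Wc by (simp add: Z_def)
    then show "inv a \<in> Z" using a Wi by (simp add: Z_def)
    fix b assume b: "b \<in> Z"
    have "conjugate G y (a \<otimes> b) = y" if "y \<in> X" for y
      using conjugate_conjugate[of y a b] a b that xc Wc by (simp add: Z_def)
    then show "a \<otimes> b \<in> Z" using a b Wm by (simp add: Z_def)
  qed
  have central: "w \<otimes> z = z \<otimes> w" if w: "w \<in> W" and z: "z \<in> Z" for w z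
  proof -
    have zc: "z \<in> carrier G" using z ZW Wc by auto
    have "conjugate G w z = w" using w[unfolded W_def]
    proof (induction rule: generate.induct)
      case (incl h)
      then show ?case using z by (simp add: Z_def)
    next
      case (inv h)
      then show ?case using z zc xc by (simp add: Z_def conjugate_inv)
    next
      case (eng h1 h2)
      then show ?case using generate_in_carrier[OF Xc] zc by (simp add: conjugate_mult)
    qed (use zc in simp)
    then have "z \<otimes> (inv z \<otimes> w \<otimes> z) = z \<otimes> w" by (simp add: conjugate_def)
    then show ?thesis using zc Wc[OF w] by (simp add: m_assoc)
  qed
  define A where "A = G\<lparr>carrier := Z\<rparr>"
  have A: "comm_group A"
    unfolding A_def
  proof (rule group.group_comm_groupI)
    show "group (G\<lparr>carrier := Z\<rparr>)" by (rule subgroup_imp_group[OF Z])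
  qed (use central ZW in auto)
  interpret A: comm_group A by fact
  have Ac [simp]: "carrier A = Z" and Am [simp]: "a \<otimes>\<^bsub>A\<^esub> b = a \<otimes> b" and A1 [simp]: "\<one>\<^bsub>A\<^esub> = \<one>"
    for a b by (simp_all add: A_def)
  have Ap [simp]: "a [^]\<^bsub>A\<^esub> (n :: nat) = a [^] n" for a n
    using nat_pow_consistent[of a n Z] by (simp add: A_def)
  \<comment> \<open>\<open>F w\<close> records the conjugation action of \<open>w\<close> on
    \<open>X\<close>. On \<open>W\<close> its fibres are the cosets of \<open>Z\<close>, so counting
    self-maps of \<open>X\<close> bounds the index.\<close>
  define F where "F w = (\<lambda>y\<in>X. conjugate G y w)" for w
  have F_eq: "F v = F w \<longleftrightarrow> (\<forall>y\<in>X. conjugate G y v = conjugate G y w)" for v w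
    by (auto simp: F_def restrict_def fun_eq_iff)
  have F_range: "F w \<in> X \<rightarrow>\<^sub>E X" if "w \<in> W" for w
    using cX that by (auto simp: F_def)
  have finE: "finite (X \<rightarrow>\<^sub>E X)" and cardE: "card (X \<rightarrow>\<^sub>E X) = m ^ m"
    using fin by (simp_all add: finite_PiE card_funcsetE m_def)
  have F_mult: "F (a \<otimes> g) = F (b \<otimes> g) \<longleftrightarrow> F a = F b" if "a \<in> W" "b \<in> W" "g \<in> W" for a b g
  proof -
    have *: "F (a \<otimes> g) = F (b \<otimes> g)" if "F a = F b" "a \<in> W" "b \<in> W" "g \<in> W" for a b g
      using that xc Wc unfolding F_eq by (simp flip: conjugate_conjugate)
    show ?thesis using *[of a b g] *[of "a \<otimes> g" "b \<otimes> g" "inv g"] that Wc Wm Wi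
      by (auto simp: m_assoc)
  qed
  have F_Z: "a \<otimes> inv b \<in> Z" if ab: "a \<in> W" "b \<in> W" "F a = F b" for a b
  proof -
    have "conjugate G y (a \<otimes> inv b) = y" if y: "y \<in> X" for y
    proof -
      have "conjugate G y (a \<otimes> inv b) = conjugate G (conjugate G y a) (inv b)"
        using y ab xc Wc by (simp add: conjugate_conjugate)
      also have "\<dots> = conjugate G (conjugate G y b) (inv b)" using y ab by (simp add: F_eq)
      also have "\<dots> = y" using y ab xc Wc by (simp add: conjugate_conjugate)
      finally show ?thesis .
    qed
    then show ?thesis using ab Wm Wi by (simp add: Z_def)
  qed
  have Z_F: "F (t \<otimes> z) = F t" if "t \<in> W" "z \<in> Z" for t z
    unfolding F_eq
  proof
    fix y assume y: "y \<in> X"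
    have "conjugate G y (t \<otimes> z) = conjugate G (conjugate G y t) z"
      using conjugate_conjugate[OF xc[OF y] Wc[OF that(1)] Wc[OF ZW[OF that(2)]]] by simp
    then show "conjugate G y (t \<otimes> z) = conjugate G y t"
      using cX[OF y that(1)] that(2) by (simp add: Z_def)
  qed
  \<comment> \<open>\<open>\<tau> a\<close> is a representative of the coset of \<open>a\<close>
    that depends only on this coset, and \<open>T\<close> is the resulting transversal.\<close>
  define \<sigma> where "\<sigma> f = (SOME b. b \<in> W \<and> F b = f)" for f
  define \<tau> where "\<tau> a = \<sigma> (F a)" for a
  have \<tau>: "\<tau> a \<in> W" "F (\<tau> a) = F a" if "a \<in> W" for a
    using someI[of "\<lambda>b. b \<in> W \<and> F b = F a" a] that by (simp_all add: \<tau>_def \<sigma>_def)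
  define T where "T = \<tau> ` W"
  have TW: "t \<in> W" if "t \<in> T" for t using that \<tau> by (auto simp: T_def)
  have \<tau>T: "\<tau> t = t" if "t \<in> T" for t using that \<tau>(2) by (auto simp: T_def \<tau>_def)
  have T_sub: "T \<subseteq> \<sigma> ` (X \<rightarrow>\<^sub>E X)" using F_range by (auto simp: T_def \<tau>_def)
  have finT: "finite T" using T_sub finE finite_subset by blast
  have cardT: "card T \<le> m ^ m" using surj_card_le[OF finE T_sub] cardE by simp
  have "\<tau> \<one> \<in> T" using subgroup.one_closed[OF W] by (simp add: T_def)
  then have "card T > 0" using finT by (auto simp: card_gt_0_iff)
  \<comment> \<open>The central factor by which \<open>t g\<close> differs from its representative;
    the transfer \<open>tr g\<close> multiplies these factors over \<open>T\<close>.\<close>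
  define c where "c t g = t \<otimes> g \<otimes> inv (\<tau> (t \<otimes> g))" for t g
  have cZ: "c t g \<in> Z" if "t \<in> W" "g \<in> W" for t g
    unfolding c_def using that Wm \<tau>[of "t \<otimes> g"] by (intro F_Z) auto
  define tr where "tr g = finprod A (\<lambda>t. c t g) T" for g
  \<comment> \<open>Right multiplication by \<open>g\<close> permutes the cosets, hence the
    transversal. This is what reindexes the second product when \<open>tr\<close> is shown to be
    multiplicative.\<close>
  have perm: "(\<lambda>t. \<tau> (t \<otimes> g)) ` T = T" "inj_on (\<lambda>t. \<tau> (t \<otimes> g)) T" if g: "g \<in> W" for g
  proof -
    show i: "inj_on (\<lambda>t. \<tau> (t \<otimes> g)) T"
    proof (rule inj_onI)
      fix s t assume s: "s \<in> T" and t: "t \<in> T" and eq: "\<tau> (s \<otimes> g) = \<tau> (t \<otimes> g)"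
      have "F (s \<otimes> g) = F (t \<otimes> g)"
        using \<tau>(2)[OF Wm[OF TW[OF s] g]] \<tau>(2)[OF Wm[OF TW[OF t] g]] eq by simp
      then have "F s = F t" using F_mult[OF TW[OF s] TW[OF t] g] by simp
      then have "\<tau> s = \<tau> t" by (simp add: \<tau>_def)
      then show "s = t" using \<tau>T s t by simp
    qed
    have "(\<lambda>t. \<tau> (t \<otimes> g)) ` T \<subseteq> T" using TW Wm g by (auto simp: T_def)
    then show "(\<lambda>t. \<tau> (t \<otimes> g)) ` T = T" using endo_inj_surj[OF finT _ i] by blast
  qed
  have "tr \<in> hom (G\<lparr>carrier := generate G X\<rparr>) A"
  proof (rule homI)
    fix g assume "g \<in> carrier (G\<lparr>carrier := generate G X\<rparr>)"
    then have g: "g \<in> W" by (simp add: W_def)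
    then show "tr g \<in> carrier A" unfolding tr_def using cZ TW by (intro A.finprod_closed) auto
    fix h assume "h \<in> carrier (G\<lparr>carrier := generate G X\<rparr>)"
    then have h: "h \<in> W" by (simp add: W_def)
    \<comment> \<open>The cocycle identity: the inverse of \<open>\<tau> (t \<otimes> g)\<close> in
      the first factor cancels against the start of the second.\<close>
    have cgh: "c t (g \<otimes> h) = c t g \<otimes>\<^bsub>A\<^esub> c (\<tau> (t \<otimes> g)) h" if t: "t \<in> T" for t
    proof -
      note w = TW[OF t] g h Wm[OF TW[OF t] g] \<tau>[OF Wm[OF TW[OF t] g]]
      have "F (\<tau> (t \<otimes> g) \<otimes> h) = F (t \<otimes> g \<otimes> h)" using F_mult w by simp
      then have "\<tau> (\<tau> (t \<otimes> g) \<otimes> h) = \<tau> (t \<otimes> (g \<otimes> h))"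
        using w Wc by (simp add: \<tau>_def m_assoc)
      then show ?thesis
        using w Wc Wc[OF \<tau>(1)[OF Wm[OF w(1) Wm[OF g h]]]] by (simp add: c_def m_assoc)
    qed
    have "tr (g \<otimes> h) = finprod A (\<lambda>t. c t g \<otimes>\<^bsub>A\<^esub> c (\<tau> (t \<otimes> g)) h) T"
      unfolding tr_def
    proof (rule A.finprod_cong')
      show "(\<lambda>t. c t g \<otimes>\<^bsub>A\<^esub> c (\<tau> (t \<otimes> g)) h) \<in> T \<rightarrow> carrier A"
        using cZ TW g h Wm \<tau>(1) by (intro Pi_I A.m_closed) simp_all
    qed (use cgh in simp_all)
    also have "\<dots> = tr g \<otimes>\<^bsub>A\<^esub> finprod A (\<lambda>t. c (\<tau> (t \<otimes> g)) h) T"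
      unfolding tr_def using cZ TW g h Wm \<tau> by (intro A.finprod_multf) (auto simp: Pi_iff)
    also have "finprod A (\<lambda>t. c (\<tau> (t \<otimes> g)) h) T = tr h"
      using A.finprod_reindex[of "\<lambda>t. c t h" "\<lambda>t. \<tau> (t \<otimes> g)" T] perm[OF g] cZ TW h
      by (auto simp: tr_def Pi_iff)
    finally show "tr (g \<otimes>\<^bsub>G\<lparr>carrier := generate G X\<rparr>\<^esub> h) = tr g \<otimes>\<^bsub>A\<^esub> tr h" by simp
  qed
  note tr = this
  note h = hom_on_subgroup[OF W[unfolded W_def] A.group_axioms tr]
  \<comment> \<open>Multiplication by a central \<open>z\<close> fixes every coset, so each factor
    of the transfer equals \<open>z\<close>.\<close>
  have tr_Z: "tr z = z [^] card T" if z: "z \<in> Z" for z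
  proof -
    have "c t z = z" if t: "t \<in> T" for t
    proof -
      have "\<tau> (t \<otimes> z) = t" using Z_F[OF TW[OF t] z] \<tau>T[OF t] by (simp add: \<tau>_def)
      then show ?thesis
        using central[OF TW[OF t] z] Wc[OF TW[OF t]] Wc[OF ZW[OF z]] by (simp add: c_def m_assoc)
    qed
    then have "tr z = finprod A (\<lambda>t. z) T"
      unfolding tr_def using z by (intro A.finprod_cong') auto
    then show ?thesis using A.finprod_const[of z T] z by simp
  qed
  have xW: "x \<in> W" unfolding W_def using x by (rule generate.incl)
  have x': "x \<in> carrier G" using x Xc by auto
  have xj: "x [^] j \<in> W" for j :: nat
    using subgroup_int_pow_closed[OF W xW, of "int j"] by (simp add: int_pow_int)
  \<comment> \<open>Two powers of \<open>x\<close> act alike on \<open>X\<close>, so their quotient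
    is central; the factorial makes the central exponent depend on \<open>m\<close> only.\<close>
  obtain i j :: nat where ij: "i < j" "F (x [^] i) = F (x [^] j)" "(j - i) dvd fact (m ^ m)"
    using pigeonhole_fact[of "\<lambda>j. F (x [^] j)", OF F_range[OF xj] finE] cardE by auto
  have "x [^] j = x [^] (j - i) \<otimes> x [^] i" using x' ij(1) by (simp add: nat_pow_mult)
  then have "x [^] (j - i) = x [^] j \<otimes> inv (x [^] i)" using x' by (simp add: m_assoc)
  then have "x [^] (j - i) \<in> Z" using F_Z[OF xj xj] ij(2) by simp
  then have "(x [^] (j - i)) [^] q \<in> Z" for q :: nat
    using subgroup_int_pow_closed[OF Z, of _ "int q"] by (simp add: int_pow_int)
  then have xN: "x [^] (fact (m ^ m) :: nat) \<in> Z"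
    using ij(3) x' by (auto simp: nat_pow_pow elim!: dvdE)
  let ?N = "fact (m ^ m) :: nat"
  have xG: "x \<in> generate G X" using xW by (simp add: W_def)
  have trx: "tr x \<in> carrier G" using h(1)[OF xG] Wc ZW by simp
  have "card (tr ` X) \<le> m" unfolding m_def using fin by (rule card_image_le)
  then have "tr x [^] e m = \<one>"
    using torsion_boundD[OF e A tr _ _ xG, of m] fin by simp
  then have "(tr x [^] ?N) [^] e m = \<one>" using trx by (simp add: nat_pow_pow mult.commute[of _ "e m"] flip: nat_pow_pow[of _ "e m"])
  \<comment> \<open>The transfer of the central element \<open>x\<^sup>N\<close> is computed in two
    ways. The remaining dependence on \<open>card T\<close> is removed by the fact that it divides
    \<open>?N\<close>.\<close>
  moreover have "tr x [^] ?N = (x [^] ?N) [^] card T"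
    using h(5)[OF xG, of ?N] tr_Z[OF xN] by simp
  ultimately have "x [^] (?N * card T * e m) = \<one>" using x' by (simp add: nat_pow_pow)
  moreover have "card T dvd ?N" using cardT \<open>card T > 0\<close> by (intro dvd_fact) auto
  ultimately show ?thesis using pow_eq_one_dvd[OF x'] by (meson mult_dvd_mono dvd_refl)
qed

section \<open>Dietzmann's lemma with an explicit bound\<close>

definition list_prod :: "'a list \<Rightarrow> 'a" where
  "list_prod xs = foldr (\<otimes>) xs \<one>"

lemma list_prod_simps [simp]:
  "list_prod [] = \<one>" "list_prod (x # xs) = x \<otimes> list_prod xs"
  by (simp_all add: list_prod_def)

lemma list_prod_closed [simp]: "set xs \<subseteq> carrier G \<Longrightarrow> list_prod xs \<in> carrier G"
  by (induction xs) auto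

lemma list_prod_append:
  "set xs \<subseteq> carrier G \<Longrightarrow> set ys \<subseteq> carrier G \<Longrightarrow> list_prod (xs @ ys) = list_prod xs \<otimes> list_prod ys"
  by (induction xs) (auto simp: m_assoc)

lemma list_prod_replicate: "x \<in> carrier G \<Longrightarrow> list_prod (replicate k x) = x [^] k"
  by (induction k) (auto, metis nat_pow_Suc nat_pow_Suc2)

text \<open>Copies of \<open>x\<close> move to the front by
  \<open>a x\<^sup>c = x\<^sup>c a'\<close>, where \<open>a'\<close> is the conjugate of
  \<open>a\<close> by \<open>x\<^sup>c\<close>. Normality keeps \<open>a'\<close> in
  \<open>X\<close>, and the number of factors is unchanged.\<close>

lemma list_prod_collect:
  assumes X: "normal_set G X" and xs: "set xs \<subseteq> X" and x: "x \<in> X"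
  shows "\<exists>ys. set ys \<subseteq> X \<and> length ys + count_list xs x = length xs \<and>
    list_prod xs = x [^] count_list xs x \<otimes> list_prod ys"
  using xs
proof (induction xs)
  case (Cons a xs)
  have Xc: "X \<subseteq> carrier G" using X by (simp add: normal_set_def)
  let ?c = "count_list xs x"
  from Cons obtain ys where ys: "set ys \<subseteq> X" "length ys + ?c = length xs"
    "list_prod xs = x [^] ?c \<otimes> list_prod ys" by auto
  have c: "x \<in> carrier G" "a \<in> carrier G" "list_prod ys \<in> carrier G" "a \<in> X" "set ys \<subseteq> carrier G"
    using Xc x Cons.prems ys by auto
  show ?case
  proof (cases "a = x")
    case True
    have "x \<otimes> (x [^] ?c \<otimes> list_prod ys) = x [^] Suc ?c \<otimes> list_prod ys"
      using c by (subst nat_pow_Suc2) (simp_all add: m_assoc)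
    then show ?thesis
      using True ys by (intro exI[of _ ys]) (simp del: nat_pow_Suc Group.nat_pow_Suc)
  next
    case False
    have "conjugate G a (x [^] ?c) \<in> X" using X c by (simp add: normal_set_def)
    moreover have "a \<otimes> (x [^] ?c \<otimes> list_prod ys) = x [^] ?c \<otimes> (conjugate G a (x [^] ?c) \<otimes> list_prod ys)"
      using c by (simp add: conjugate_def m_assoc)
    ultimately show ?thesis
      using False ys by (intro exI[of _ "conjugate G a (x [^] ?c) # ys"]) simp
  qed
qed simp

text \<open>In a shortest product each element of \<open>X\<close> occurs fewer than
  \<open>N\<close> times, since \<open>N\<close> collected copies could be dropped. So every element
  is a product of at most \<open>card X * N\<close> factors, and such lists are counted.\<close>

lemma Dietzmann_bound:
  assumes X: "normal_set G X" and fin: "finite X" and N: "N > 0"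
    and one: "\<And>x. x \<in> X \<Longrightarrow> x [^] (N::nat) = \<one>"
  shows "finite (generate G X)" "card (generate G X) \<le> (\<Sum>i\<le>card X * N. card X ^ i)"
proof -
  have Xc: "X \<subseteq> carrier G" using X by (simp add: normal_set_def)
  have ex: "\<exists>xs. set xs \<subseteq> X \<and> list_prod xs = w" if "w \<in> generate G X" for w
    using that
  proof (induction rule: generate.induct)
    case one
    show ?case by (rule exI[of _ "[]"]) simp
  next
    case (incl h)
    then show ?case using Xc by (intro exI[of _ "[h]"]) auto
  next
    case (inv h)
    have hc: "h \<in> carrier G" using inv Xc by auto
    have "h [^] (N - 1) \<otimes> h = \<one>" using assms(4)[OF inv] N by (cases N) auto
    \<comment> \<open>Inverses are positive powers, so products of elements of \<open>X\<close>
      alone exhaust the generated subgroup.\<close>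
    then have "inv h = h [^] (N - 1)" using hc by (intro inv_equality) auto
    then show ?case using inv hc by (intro exI[of _ "replicate (N - 1) h"]) (auto simp: list_prod_replicate)
  next
    case (eng h1 h2)
    then obtain xs ys where "set xs \<subseteq> X" "list_prod xs = h1" "set ys \<subseteq> X" "list_prod ys = h2" by auto
    then show ?case using Xc by (intro exI[of _ "xs @ ys"]) (auto simp: list_prod_append)
  qed
  let ?S = "{xs. set xs \<subseteq> X \<and> length xs \<le> card X * N}"
  have "w \<in> list_prod ` ?S" if w: "w \<in> generate G X" for w
  proof -
    let ?P = "\<lambda>xs. set xs \<subseteq> X \<and> list_prod xs = w"
    obtain xs0 where "?P xs0" using ex[OF w] by blast
    from ex_has_least_nat[of ?P, OF this, of length] obtain xs
      where xs: "set xs \<subseteq> X" "list_prod xs = w"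
        and least: "\<And>ys. set ys \<subseteq> X \<Longrightarrow> list_prod ys = w \<Longrightarrow> length xs \<le> length ys"
      by (elim exE conjE) simp
    have "count_list xs x < N" if x: "x \<in> X" for x
    proof (rule ccontr)
      assume "\<not> count_list xs x < N"
      then have c: "count_list xs x = N + (count_list xs x - N)" by simp
      obtain ys where ys: "set ys \<subseteq> X" "length ys + count_list xs x = length xs"
        "list_prod xs = x [^] count_list xs x \<otimes> list_prod ys"
        using list_prod_collect[OF X xs(1) x] by auto
      have xc: "x \<in> carrier G" using x Xc by auto
      have "x [^] count_list xs x = x [^] (count_list xs x - N)"
        by (subst c, subst nat_pow_mult[OF xc, symmetric]) (use one[OF x] xc in simp)
      moreover have "set ys \<subseteq> carrier G" using ys Xc by auto
      ultimately have "list_prod (replicate (count_list xs x - N) x @ ys) = w"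
        using xs ys xc by (subst list_prod_append) (auto simp: list_prod_replicate)
      then have "length xs \<le> length (replicate (count_list xs x - N) x @ ys)"
        using x ys by (intro least) auto
      then show False using ys(2) c N by simp
    qed
    then have "length xs \<le> (\<Sum>x\<in>X. N)"
      unfolding sum_count_set[OF xs(1) fin, symmetric] by (intro sum_mono) (simp add: less_imp_le)
    then show ?thesis using xs by auto
  qed
  then have sub: "generate G X \<subseteq> list_prod ` ?S" by blast
  have fS: "finite ?S" using fin by (rule finite_lists_length_le)
  show "finite (generate G X)" using sub fS finite_subset by blast
  show "card (generate G X) \<le> (\<Sum>i\<le>card X * N. card X ^ i)"
    using surj_card_le[OF fS sub] card_lists_length_le[OF fin, of "card X * N"] by simp
qed

end

section \<open>Values of the derived words\<close>

lemma word_val_group_hom: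
  assumes "group_hom G H f" "g \<in> UNIV \<rightarrow> carrier G"
  shows "f (word_val G g w) = word_val H (\<lambda>i. f (g i)) w"
proof -
  interpret f: group_hom G H f by fact
  have gi: "g i \<in> carrier G" for i using assms(2) by auto
  have l: "f (letter_val G g a) = letter_val H (\<lambda>i. f (g i)) a" for a
    using gi by (simp add: letter_val_def)
  show ?thesis
  proof (induction w)
    case Nil
    then show ?case by (simp add: word_val_def)
  next
    case (Cons a w)
    then show ?case
      using assms(2) f.G.letter_val_closed f.G.word_val_closed by (simp add: word_val_Cons l)
  qed
qed

lemma (in group) group_hom_conjugate:
  "a \<in> carrier G \<Longrightarrow> group_hom G G (\<lambda>x. conjugate G x a)"
  by (auto simp: group_hom_def group_hom_axioms_def group_axioms conjugate_mult intro!: homI)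

lemma (in group) word_valuesI:
  "g \<in> UNIV \<rightarrow> carrier G \<Longrightarrow> word_val G g w \<in> word_values w G"
  unfolding word_values_def by blast

lemma word_values_iff:
  "x \<in> word_values w G \<longleftrightarrow> (\<exists>g. g \<in> UNIV \<rightarrow> carrier G \<and> x = word_val G g w)"
  by (auto simp: word_values_def)

lemma (in group) word_values_closed: "word_values w G \<subseteq> carrier G"
  using word_val_closed by (auto simp: word_values_def)

lemma (in group) normal_set_word_values: "normal_set G (word_values w G)"
proof -
  have "conjugate G (word_val G g w) a \<in> word_values w G"
    if g: "g \<in> UNIV \<rightarrow> carrier G" and a: "a \<in> carrier G" for g a
  proof -
    have "(\<lambda>i. conjugate G (g i) a) \<in> UNIV \<rightarrow> carrier G" using g a by (auto simp: Pi_iff)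
    then show ?thesis
      using word_val_group_hom[OF group_hom_conjugate[OF a] g] word_valuesI by simp
  qed
  then show ?thesis
    using word_values_closed unfolding normal_set_def by (auto simp: word_values_def)
qed

text \<open>Arbitrary sets \<open>S i\<close> are allowed so that the second half, with indices
  shifted by \<open>2 ^ k\<close>, is again of this form.\<close>

definition derived_values :: "('a, 'b) monoid_scheme \<Rightarrow> (nat \<Rightarrow> 'a set) \<Rightarrow> nat \<Rightarrow> 'a set" where
  "derived_values G S k =
     {word_val G h (derived_word k) |h. h \<in> UNIV \<rightarrow> carrier G \<and> (\<forall>i\<in>{1..2 ^ k}. h i \<in> S i)}"

lemma (in group) derived_values_0:
  assumes "S 1 \<subseteq> carrier G"
  shows "derived_values G S 0 = S 1"
proof safe
  fix x assume x: "x \<in> S 1"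
  then have h: "(\<lambda>_. x) \<in> UNIV \<rightarrow> carrier G" using assms by auto
  then show "x \<in> derived_values G S 0"
    unfolding derived_values_def using x word_val_var[OF h, of 1] by (intro CollectI exI[of _ "\<lambda>_. x"]) simp
qed (auto simp: derived_values_def word_val_var)

lemma (in group) derived_values_Suc:
  "derived_values G S (Suc k) =
     comm_values G (derived_values G S k) (derived_values G (\<lambda>i. S (2 ^ k + i)) k)"
proof safe
  fix x assume "x \<in> derived_values G S (Suc k)"
  then obtain h where h: "h \<in> UNIV \<rightarrow> carrier G" "\<And>i. i \<in> {1..2 ^ Suc k} \<Longrightarrow> h i \<in> S i"
    and x: "x = word_val G h (derived_word (Suc k))" by (auto simp: derived_values_def)
  have "word_val G h (derived_word k) \<in> derived_values G S k"
    unfolding derived_values_def using h by (intro CollectI exI[of _ h]) auto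
  moreover have "word_val G (\<lambda>i. h (2 ^ k + i)) (derived_word k)
      \<in> derived_values G (\<lambda>i. S (2 ^ k + i)) k"
    unfolding derived_values_def using h by (intro CollectI exI[of _ "\<lambda>i. h (2 ^ k + i)"]) auto
  ultimately show "x \<in> comm_values G (derived_values G S k) (derived_values G (\<lambda>i. S (2 ^ k + i)) k)"
    unfolding x word_val_derived_word_Suc[OF h(1)] comm_values_def by blast
next
  fix x assume "x \<in> comm_values G (derived_values G S k) (derived_values G (\<lambda>i. S (2 ^ k + i)) k)"
  then obtain h1 h2 where h1: "h1 \<in> UNIV \<rightarrow> carrier G" "\<And>i. i \<in> {1..2 ^ k} \<Longrightarrow> h1 i \<in> S i"
    and h2: "h2 \<in> UNIV \<rightarrow> carrier G" "\<And>i. i \<in> {1..2 ^ k} \<Longrightarrow> h2 i \<in> S (2 ^ k + i)"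
    and x: "x = commutator G (word_val G h1 (derived_word k)) (word_val G h2 (derived_word k))"
    by (auto simp: comm_values_def derived_values_def)
  \<comment> \<open>The two substitutions are glued along the index blocks up to
    \<open>2 ^ k\<close> and beyond it.\<close>
  define h where "h i = (if i \<le> 2 ^ k then h1 i else h2 (i - 2 ^ k))" for i
  have h: "h \<in> UNIV \<rightarrow> carrier G" using h1(1) h2(1) by (auto simp: h_def Pi_iff)
  have "h i \<in> S i" if "i \<in> {1..2 ^ Suc k}" for i
  proof (cases "i \<le> 2 ^ k")
    case True
    then show ?thesis using h1(2)[of i] that by (simp add: h_def)
  next
    case False
    then have "i - 2 ^ k \<in> {1..2 ^ k}" using that by auto
    then show ?thesis using h2(2)[of "i - 2 ^ k"] False by (simp add: h_def)
  qed
  moreover have "word_val G h (derived_word k) = word_val G h1 (derived_word k)"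
    using vars_derived_word[of k] by (intro word_val_cong) (auto simp: h_def)
  moreover have "word_val G (\<lambda>i. h (2 ^ k + i)) (derived_word k) = word_val G h2 (derived_word k)"
    using vars_derived_word[of k] by (intro word_val_cong) (auto simp: h_def)
  ultimately show "x \<in> derived_values G S (Suc k)"
    unfolding derived_values_def using h
    by (intro CollectI exI[of _ h]) (auto simp: x word_val_derived_word_Suc[OF h] simp del: derived_word.simps)
qed

lemma chain_exponent_pos: "(\<And>m. e m > 0) \<Longrightarrow> chain_exponent e r m > 0"
  by (induction r arbitrary: m) auto

text \<open>The order of quantifiers carries the uniformity: \<open>n\<close>, \<open>r\<close> and
  \<open>e\<close> are chosen before \<open>G\<close> and \<open>S\<close>. Positivity of
  \<open>e\<close> is recorded for the exponent in \<open>Dietzmann_bound\<close>.\<close>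

lemma torsion_data_derived_values:
  assumes "\<And>i. i \<in> {1..2 ^ k} \<Longrightarrow> \<nu> i \<noteq> 0"
  shows "\<exists>n r e. n \<noteq> 0 \<and> (\<forall>m. e m > 0) \<and>
    (\<forall>(G :: ('a, 'b) monoid_scheme) S. group G \<longrightarrow>
       (\<forall>i\<in>{1..2 ^ k}. normal_set G (S i) \<and> (\<forall>c\<in>carrier G. c [^]\<^bsub>G\<^esub> (\<nu> i :: int) \<in> S i)) \<longrightarrow>
       torsion_data G (derived_values G S k) n r e)"
  using assms
proof (induction k arbitrary: \<nu>)
  case 0
  let ?e = "\<lambda>m. nat \<bar>\<nu> 1\<bar> * fact m"
  have "torsion_data G (derived_values G S 0) (\<nu> 1) 0 ?e"
    if "group G" "\<forall>i\<in>{1..2 ^ 0}. normal_set G (S i) \<and> (\<forall>c\<in>carrier G. c [^]\<^bsub>G\<^esub> \<nu> i \<in> S i)"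
    for G :: "('a, 'b) monoid_scheme" and S
  proof -
    interpret group G by fact
    have "S 1 \<subseteq> carrier G" using that(2) by (simp add: normal_set_def)
    from derived_values_0[of S, OF this] show ?thesis
      using that(2) torsion_data_powers[of "S 1" "\<nu> 1"] by simp
  qed
  then show ?case
    using 0[of 1] by (intro exI[of _ "\<nu> 1"] exI[of _ "0::nat"] exI[of _ ?e]) simp
next
  case (Suc k)
  have "\<nu> i \<noteq> 0" if "i \<in> {1..2 ^ k}" for i using that Suc.prems[of i] by simp
  from Suc.IH[of \<nu>, OF this] obtain n r d where n: "n \<noteq> 0" "\<And>m. d m > 0"
    and d: "\<And>(G :: ('a, 'b) monoid_scheme) S. group G \<Longrightarrow>
       (\<forall>i\<in>{1..2 ^ k}. normal_set G (S i) \<and> (\<forall>c\<in>carrier G. c [^]\<^bsub>G\<^esub> \<nu> i \<in> S i)) \<Longrightarrow>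
       torsion_data G (derived_values G S k) n r d" by blast
  have "\<nu> (2 ^ k + i) \<noteq> 0" if "i \<in> {1..2 ^ k}" for i using that Suc.prems[of "2 ^ k + i"] by simp
  from Suc.IH[of "\<lambda>i. \<nu> (2 ^ k + i)", OF this] obtain n' r' e where e0: "\<And>m. e m > 0"
    and e: "\<And>(G :: ('a, 'b) monoid_scheme) S. group G \<Longrightarrow>
       (\<forall>i\<in>{1..2 ^ k}. normal_set G (S i) \<and> (\<forall>c\<in>carrier G. c [^]\<^bsub>G\<^esub> \<nu> (2 ^ k + i) \<in> S i)) \<Longrightarrow>
       torsion_data G (derived_values G S k) n' r' e" by blast
  let ?e = "\<lambda>m. (nat \<bar>n\<bar> * fact m) * chain_exponent (\<lambda>m. d m * e m) (Suc r) m"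
  have pos: "?e m > 0" for m using n e0 chain_exponent_pos[of "\<lambda>m. d m * e m" "Suc r" m] by simp
  have td: "torsion_data G (derived_values G S (Suc k)) n (Suc r) ?e"
    if G: "group G" and S: "\<forall>i\<in>{1..2 ^ Suc k}. normal_set G (S i) \<and> (\<forall>c\<in>carrier G. c [^]\<^bsub>G\<^esub> \<nu> i \<in> S i)"
    for G :: "('a, 'b) monoid_scheme" and S
    unfolding group.derived_values_Suc[OF G]
    by (rule group.torsion_data_comm_values[OF G d[OF G] e[of G "\<lambda>i. S (2 ^ k + i)", OF G]])
       (use S in auto)
  show ?case
    by (intro exI[of _ n] exI[of _ "Suc r"] exI[of _ ?e] conjI allI impI n(1) pos td)
qed

text \<open>Disjointness makes the values of the words \<open>u i\<close> independent: separate
  substitutions for them combine into a single one.\<close>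

lemma word_values_derived_word_subst:
  assumes G: "group G" and u: "\<And>i. i \<in> {1..2 ^ k} \<Longrightarrow> u i \<in> carrier \<F>"
    and disj: "disjoint_family_on (\<lambda>i. vars (u i)) {1..2 ^ k}"
  shows "word_values (word_val \<F> u (derived_word k)) G = derived_values G (\<lambda>i. word_values (u i) G) k"
proof -
  interpret group G by fact
  \<comment> \<open>Outside the relevant indices \<open>u\<close> may take values that are not
    reduced words; the identity replaces them so that \<open>word_val_subst\<close> applies.\<close>
  define u' where "u' i = (if i \<in> {1..2 ^ k} then u i else \<one>\<^bsub>\<F>\<^esub>)" for i
  have u': "u' \<in> UNIV \<rightarrow> carrier \<F>" using u by (auto simp: u'_def)
  have uu': "word_val \<F> u (derived_word k) = word_val \<F> u' (derived_word k)"
    using vars_derived_word[of k] by (intro word_val_cong) (auto simp: u'_def)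
  have w: "word_val G g (word_val \<F> u (derived_word k)) = word_val G (\<lambda>i. word_val G g (u' i)) (derived_word k)"
    if "g \<in> UNIV \<rightarrow> carrier G" for g
    unfolding uu' by (rule word_val_subst[OF u' that])
  show ?thesis
  proof safe
    fix x assume "x \<in> word_values (word_val \<F> u (derived_word k)) G"
    then obtain g where g: "g \<in> UNIV \<rightarrow> carrier G" "x = word_val G g (word_val \<F> u (derived_word k))"
      by (auto simp: word_values_def)
    have "(\<lambda>i. word_val G g (u' i)) \<in> UNIV \<rightarrow> carrier G" using word_val_closed[OF g(1)] by auto
    moreover have "word_val G g (u' i) \<in> word_values (u i) G" if "i \<in> {1..2 ^ k}" for i
      using word_valuesI[OF g(1)] that by (simp add: u'_def)
    ultimately show "x \<in> derived_values G (\<lambda>i. word_values (u i) G) k"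
      unfolding g(2) w[OF g(1)] derived_values_def by blast
  next
    fix x assume "x \<in> derived_values G (\<lambda>i. word_values (u i) G) k"
    then obtain h where x: "x = word_val G h (derived_word k)"
      and h: "\<And>i. i \<in> {1..2 ^ k} \<Longrightarrow> h i \<in> word_values (u i) G"
      by (auto simp: derived_values_def)
    have "\<forall>i\<in>{1..2 ^ k}. \<exists>g. g \<in> UNIV \<rightarrow> carrier G \<and> h i = word_val G g (u i)"
      using h word_values_iff by metis
    then obtain g where g: "\<And>i. i \<in> {1..2 ^ k} \<Longrightarrow> g i \<in> UNIV \<rightarrow> carrier G"
      "\<And>i. i \<in> {1..2 ^ k} \<Longrightarrow> h i = word_val G (g i) (u i)" by metis
    \<comment> \<open>A variable \<open>j\<close> is evaluated by the substitution belonging to the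
      unique word \<open>u i\<close> that involves it; all other variables become the
      identity.\<close>
    define b where "b j = (if \<exists>i\<in>{1..2 ^ k}. j \<in> vars (u i)
      then g (SOME i. i \<in> {1..2 ^ k} \<and> j \<in> vars (u i)) j else \<one>\<^bsub>G\<^esub>)" for j
    have b_eq: "b j = g i j" if i: "i \<in> {1..2 ^ k}" and j: "j \<in> vars (u i)" for i j
    proof -
      have "i' = i" if "i' \<in> {1..2 ^ k}" "j \<in> vars (u i')" for i'
        using disj i j that unfolding disjoint_family_on_def by blast
      then have eq: "(SOME i. i \<in> {1..2 ^ k} \<and> j \<in> vars (u i)) = i"
        using i j by (intro some_equality) blast+
      have "\<exists>i\<in>{1..2 ^ k}. j \<in> vars (u i)" using i j by blast
      then show ?thesis by (simp only: b_def eq if_True)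
    qed
    have "b j \<in> carrier G" for j
    proof (cases "\<exists>i\<in>{1..2 ^ k}. j \<in> vars (u i)")
      case True
      then obtain i where i: "i \<in> {1..2 ^ k}" "j \<in> vars (u i)" by blast
      then show ?thesis using b_eq[OF i] g(1)[OF i(1)] by auto
    qed (simp add: b_def)
    then have b: "b \<in> UNIV \<rightarrow> carrier G" by auto
    have "x = word_val G (\<lambda>i. word_val G b (u' i)) (derived_word k)"
      unfolding x
    proof (rule word_val_cong)
      fix i assume "i \<in> vars (derived_word k)"
      then have i: "i \<in> {1..2 ^ k}" using vars_derived_word by blast
      have "word_val G b (u i) = word_val G (g i) (u i)" using b_eq[OF i] by (rule word_val_cong)
      then show "h i = word_val G b (u' i)" using i g(2)[OF i] by (simp add: u'_def)
    qed
    then show "x \<in> word_values (word_val \<F> u (derived_word k)) G"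
      using w[OF b] word_valuesI[OF b] by metis
  qed
qed

section \<open>Bounded conciseness\<close>

text \<open>The values of \<open>u i\<close> contain all powers for some nonzero exponent sum. The
  resulting torsion bound limits the orders of the values through the transfer, and
  \<open>Dietzmann_bound\<close> then gives \<open>f\<close>.\<close>

lemma concise_with_derived_word_subst:
  assumes u: "\<And>i. i \<in> {1..2 ^ k} \<Longrightarrow> non_commutator_word (u i)"
    and disj: "disjoint_family_on (\<lambda>i. vars (u i)) {1..2 ^ k}"
  shows "\<exists>f. concise_with TYPE('a) (word_val \<F> u (derived_word k)) f"
proof -
  let ?w = "word_val \<F> u (derived_word k)"
  have "\<forall>i\<in>{1..2 ^ k}. \<exists>j. exponent_sum j (u i) \<noteq> 0"
    using u by (simp add: non_commutator_word_exponent_sum)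
  then obtain j where j: "\<And>i. i \<in> {1..2 ^ k} \<Longrightarrow> exponent_sum (j i) (u i) \<noteq> 0" by metis
  obtain n r e where e: "\<And>m. (e m :: nat) > 0"
    and td: "\<And>(G :: 'a monoid) S. group G \<Longrightarrow>
       (\<forall>i\<in>{1..2 ^ k}. normal_set G (S i) \<and>
          (\<forall>c\<in>carrier G. c [^]\<^bsub>G\<^esub> exponent_sum (j i) (u i) \<in> S i)) \<Longrightarrow>
       torsion_data G (derived_values G S k) n r e"
    using torsion_data_derived_values[of k "\<lambda>i. exponent_sum (j i) (u i)"] j by metis
  let ?N = "\<lambda>m. fact (m ^ m) * fact (m ^ m) * e m"
  have "finite (verbal_subgroup ?w G) \<and>
      card (verbal_subgroup ?w G) \<le> (\<Sum>i\<le>card (word_values ?w G) * ?N (card (word_values ?w G)). card (word_values ?w G) ^ i)"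
    if G: "group G" and fin: "finite (word_values ?w G)" for G :: "'a monoid"
  proof -
    interpret group G by fact
    let ?X = "word_values ?w G"
    have X: "?X = derived_values G (\<lambda>i. word_values (u i) G) k"
      using u disj by (intro word_values_derived_word_subst[OF G]) (auto simp: non_commutator_word_def)
    have "torsion_data G ?X n r e"
      unfolding X using normal_set_word_values power_in_word_values by (intro td[OF G]) blast
    then have X: "normal_set G ?X" "torsion_bound G ?X e" by (simp_all add: torsion_data_def)
    have "?N (card ?X) > 0" using e by simp
    from Dietzmann_bound[OF X(1) fin this pow_eq_one_if_torsion_bound[OF X(1) fin X(2)]]
    show ?thesis by (simp add: verbal_subgroup_def)
  qed
  then show ?thesis
    unfolding concise_with_def
    by (intro exI[of _ "\<lambda>m. \<Sum>i\<le>m * ?N m. m ^ i"]) blast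
qed

section \<open>Transport from groups on the natural numbers to arbitrary groups\<close>

lemma word_values_iso:
  assumes f: "group_hom G H f" and bij: "bij_betw f (carrier G) (carrier H)"
  shows "word_values w H = f ` word_values w G"
    and "verbal_subgroup w H = f ` verbal_subgroup w G"
proof -
  interpret f: group_hom G H f by fact
  show *: "word_values w H = f ` word_values w G"
  proof safe
    fix y assume "y \<in> word_values w H"
    then obtain h where h: "h \<in> UNIV \<rightarrow> carrier H" "y = word_val H h w" by (auto simp: word_values_def)
    let ?g = "\<lambda>i. inv_into (carrier G) f (h i)"
    have hi: "h i \<in> f ` carrier G" for i using h(1) bij by (auto simp: bij_betw_def)
    have g: "?g \<in> UNIV \<rightarrow> carrier G" using inv_into_into[OF hi] by blast
    have "f (word_val G ?g w) = y"
      unfolding word_val_group_hom[OF f g] h(2) using f_inv_into_f[OF hi] by simp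
    then show "y \<in> f ` word_values w G" using f.G.word_valuesI[OF g] by blast
  next
    fix x assume "x \<in> word_values w G"
    then obtain g where g: "g \<in> UNIV \<rightarrow> carrier G" "x = word_val G g w" by (auto simp: word_values_def)
    have "(\<lambda>i. f (g i)) \<in> UNIV \<rightarrow> carrier H" using g(1) by (auto simp: Pi_iff)
    then show "f x \<in> word_values w H"
      unfolding g(2) word_val_group_hom[OF f g(1)] by (rule f.H.word_valuesI)
  qed
  show "verbal_subgroup w H = f ` verbal_subgroup w G"
    unfolding verbal_subgroup_def * by (rule f.generate_img[OF f.G.word_values_closed])
qed

lemma (in group) word_val_subgroup:
  assumes "subgroup H G" "g \<in> UNIV \<rightarrow> H"
  shows "word_val (G\<lparr>carrier := H\<rparr>) g w = word_val G g w"
  using assms by (induction w) (auto simp: word_val_def letter_val_def Pi_iff)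

text \<open>Choose one substitution for each of the finitely many values; the subgroup generated by
  all elements substituted already realizes every value.\<close>

lemma (in group) countable_subgroup_word_values:
  assumes fin: "finite (word_values w G)"
  obtains H where "subgroup H G" "countable H"
    "word_values w (G\<lparr>carrier := H\<rparr>) = word_values w G"
    "verbal_subgroup w (G\<lparr>carrier := H\<rparr>) = verbal_subgroup w G"
proof -
  have "\<forall>v\<in>word_values w G. \<exists>g. g \<in> UNIV \<rightarrow> carrier G \<and> v = word_val G g w"
    by (simp add: word_values_iff)
  then obtain g where g: "\<And>v. v \<in> word_values w G \<Longrightarrow> g v \<in> UNIV \<rightarrow> carrier G"
    "\<And>v. v \<in> word_values w G \<Longrightarrow> v = word_val G (g v) w" by metis
  define D where "D = insert \<one> (\<Union>v\<in>word_values w G. range (g v))"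
  have D: "countable D" "D \<noteq> {}" "D \<subseteq> carrier G"
    using g(1) countable_finite[OF fin] by (auto simp: D_def)
  \<comment> \<open>Enumerating \<open>D\<close> as a substitution presents \<open>H\<close> as a
    homomorphic image of the countable free group. The identity in \<open>D\<close> ensures that
    there is something to enumerate.\<close>
  define a where "a = from_nat_into D"
  have ra: "range a = D" using D by (simp add: a_def range_from_nat_into)
  then have a: "a \<in> UNIV \<rightarrow> carrier G" using D(3) by auto
  define H where "H = word_val G a ` carrier \<F>"
  interpret h: group_hom \<F> G "word_val G a" using a by (rule group_hom_word_val)
  have H: "subgroup H G" unfolding H_def by (rule h.img_is_subgroup)
  have cH: "countable H" unfolding H_def by simp
  have DH: "D \<subseteq> H"
  proof
    fix x assume "x \<in> D"
    then obtain i where "x = a i" using ra by auto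
    then have "x = word_val G a (var i)" using word_val_var[OF a] by simp
    then show "x \<in> H" by (simp add: H_def)
  qed
  have HG: "H \<subseteq> carrier G" using H by (rule subgroup.subset)
  interpret K: group "G\<lparr>carrier := H\<rparr>" using H by (rule subgroup_imp_group)
  have W: "word_values w (G\<lparr>carrier := H\<rparr>) = word_values w G"
  proof safe
    fix x assume "x \<in> word_values w (G\<lparr>carrier := H\<rparr>)"
    then obtain b where b: "b \<in> UNIV \<rightarrow> H" "x = word_val G b w"
      using word_val_subgroup[OF H] by (auto simp: word_values_def)
    then show "x \<in> word_values w G" using HG word_valuesI[of b w] by auto
  next
    fix x assume x: "x \<in> word_values w G"
    have "g x \<in> UNIV \<rightarrow> H" using x DH by (auto simp: D_def)
    then show "x \<in> word_values w (G\<lparr>carrier := H\<rparr>)"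
      using K.word_valuesI[of "g x" w] g(2)[OF x] word_val_subgroup[OF H, of "g x" w] by simp
  qed
  have "word_values w G \<subseteq> H" using K.word_values_closed[of w] W by simp
  then have "verbal_subgroup w (G\<lparr>carrier := H\<rparr>) = verbal_subgroup w G"
    unfolding verbal_subgroup_def W by (rule generate_consistent[OF _ H])
  with H cH W show ?thesis by (rule that)
qed

text \<open>A countable subgroup with the same values and verbal subgroup is copied onto natural
  numbers, where \<open>f\<close> applies; the isomorphism preserves both cardinalities.\<close>

lemma concise_with_transfer:
  assumes f: "concise_with TYPE(nat) w f"
  shows "concise_with TYPE('a) w f"
  unfolding concise_with_def
proof safe
  fix G :: "'a monoid"
  assume G: "group G" and fin: "finite (word_values w G)"
  interpret group G by fact
  obtain H where H: "subgroup H G" "countable H"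
    "word_values w (G\<lparr>carrier := H\<rparr>) = word_values w G"
    "verbal_subgroup w (G\<lparr>carrier := H\<rparr>) = verbal_subgroup w G"
    using countable_subgroup_word_values[OF fin] .
  let ?K = "G\<lparr>carrier := H\<rparr>"
  interpret K: group ?K using H(1) by (rule subgroup_imp_group)
  let ?\<iota> = "to_nat_on H"
  have inj: "inj_on ?\<iota> H" using H(2) by (rule inj_on_to_nat_on)
  define N :: "nat monoid" where
    "N = \<lparr>carrier = ?\<iota> ` H, mult = (\<lambda>x y. ?\<iota> (inv_into H ?\<iota> x \<otimes>\<^bsub>G\<^esub> inv_into H ?\<iota> y)), one = ?\<iota> \<one>\<^bsub>G\<^esub>\<rparr>"
  have iso: "?\<iota> \<in> iso ?K N"
    using inj subgroup.m_closed[OF H(1)] by (auto simp: iso_def hom_def N_def bij_betw_def)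
  \<comment> \<open>The record update leaves \<open>N\<close> unchanged, because its identity is
    already the code of the identity of \<open>G\<close>.\<close>
  have "group (N\<lparr>one := ?\<iota> \<one>\<^bsub>G\<^esub>\<rparr>)" using K.iso_imp_img_group[OF iso] by simp
  then have N: "group N" by (simp add: N_def)
  have hom: "group_hom ?K N ?\<iota>"
    using iso N K.group_axioms by (simp add: group_hom_def group_hom_axioms_def iso_def)
  have bij: "bij_betw ?\<iota> (carrier ?K) (carrier N)" using iso by (simp add: iso_def)
  note v = word_values_iso[OF hom bij, of w, unfolded H(3,4)]
  have sub: "word_values w G \<subseteq> H" "verbal_subgroup w G \<subseteq> H"
    using K.word_values_closed[of w] K.generate_in_carrier[OF K.word_values_closed, of _ w] H(3,4)
    by (auto simp: verbal_subgroup_def)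
  have "finite (word_values w N)" using v(1) fin by simp
  then have c: "finite (verbal_subgroup w N)" "card (verbal_subgroup w N) \<le> f (card (word_values w N))"
    using f N unfolding concise_with_def by blast+
  have "inj_on ?\<iota> (word_values w G)" "inj_on ?\<iota> (verbal_subgroup w G)"
    using inj sub inj_on_subset by blast+
  then show "finite (verbal_subgroup w G)"
    "card (verbal_subgroup w G) \<le> f (card (word_values w G))"
    using c by (simp_all add: v card_image finite_image_iff)
qed

text \<open>Existence on \<open>nat\<close> makes the chosen function a valid one there, and the
  transfer carries this same function to \<open>'a\<close>.\<close>

lemma boundedly_conciseI:
  assumes "\<exists>f. concise_with TYPE(nat) w f"
  shows "boundedly_concise TYPE('a) w"
proof -
  have "concise_with TYPE(nat) w (conciseness_function w)"
    unfolding conciseness_function_def using assms by (rule someI_ex)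
  then show ?thesis using concise_with_transfer by (auto simp: boundedly_concise_def)
qed

theorem corollary3p7:
  fixes k :: nat
  assumes "k \<ge> 1"
  shows "(\<forall>u :: nat \<Rightarrow> word.
            (\<forall>i\<in>{1..2 ^ k}. non_commutator_word (u i)) \<and>
            disjoint_family_on (\<lambda>i. vars (u i)) {1..2 ^ k} \<longrightarrow>
            boundedly_concise TYPE('a) (word_val \<F> u (derived_word k))) \<and>
         (\<forall>n :: nat \<Rightarrow> int.
            (\<forall>i\<in>{1..2 ^ k}. n i \<noteq> 0) \<longrightarrow>
            boundedly_concise TYPE('a)
              (word_val \<F> (\<lambda>i. var i [^]\<^bsub>\<F>\<^esub> n i) (derived_word k)))"
proof (intro conjI allI impI)
  fix u :: "nat \<Rightarrow> word"
  assume "(\<forall>i\<in>{1..2 ^ k}. non_commutator_word (u i)) \<and>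
            disjoint_family_on (\<lambda>i. vars (u i)) {1..2 ^ k}"
  then show "boundedly_concise TYPE('a) (word_val \<F> u (derived_word k))"
    by (intro boundedly_conciseI concise_with_derived_word_subst) auto
next
  fix n :: "nat \<Rightarrow> int"
  assume n: "\<forall>i\<in>{1..2 ^ k}. n i \<noteq> 0"
  \<comment> \<open>The powers are a special case of the first claim: the exponent sum of the
    \<open>i\<close>-th one in its own variable is \<open>n i\<close>, and no two involve a common
    variable.\<close>
  have "exponent_sum i (var i [^]\<^bsub>\<F>\<^esub> n i) = n i" for i
    by (simp add: exponent_sum_int_pow)
  then have "non_commutator_word (var i [^]\<^bsub>\<F>\<^esub> n i)" if "i \<in> {1..2 ^ k}" for i
    unfolding non_commutator_word_exponent_sum using n that by (metis F.int_pow_closed var_closed)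
  moreover have "vars (var i [^]\<^bsub>\<F>\<^esub> n i) \<subseteq> {i}" for i
    using vars_int_pow[OF var_closed, of i "n i"] by simp
  then have "disjoint_family_on (\<lambda>i. vars (var i [^]\<^bsub>\<F>\<^esub> n i)) {1..2 ^ k}"
    unfolding disjoint_family_on_def by blast
  ultimately show "boundedly_concise TYPE('a) (word_val \<F> (\<lambda>i. var i [^]\<^bsub>\<F>\<^esub> n i) (derived_word k))"
    by (intro boundedly_conciseI concise_with_derived_word_subst) auto
qed

end
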